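(* Let $k\geq 2$ and $n\geq 3k^2-k-2$ be integers. If $G$ is an $F_k$-free graph of order $n$, then $q_1(G)\leq q_1(S_{n,k})$, with equality if and only if $G=S_{n,k}$.
   Context: All graphs are finite, simple and undirected. For a graph $G$, the signless Laplacian matrix is $Q(G)=D(G)+A(G)$, where $A(G)$ is the adjacency matrix and $D(G)$ is the diagonal matrix of vertex degrees; $q_1(G)$ denotes the largest eigenvalue of $Q(G)$ (the signless Laplacian spectral radius). The $k$-fan $F_k=K_1\nabla kK_2$ is the graph consisting of $k$ triangles sharing exactly one common vertex, where $G\nabla H$ denotes the join (disjoint union of $G$ and $H$ plus all edges between them) and $kK_2$ is $k$ disjoint edges. $S_{n,k}=K_k\nabla (n-k)K_1$ is the complete split graph on $n$ vertices: a clique on $k$ vertices and an independent set on the remaining $n-k$ vertices, with every clique vertex adjacent to every independent-set vertex. A graph is $F_k$-free if it contains no subgraph isomorphic to $F_k$. *)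

theory Defs
  imports
    Complex_Main
    "Graph_Theory.Graph_Theory"
    "Jordan_Normal_Form.Spectral_Radius"
begin

text \<open>
  A finite simple undirected graph is a \<open>pair_graph\<close>: a finite loop-free symmetric digraph whose
  arcs are pairs of vertices, so that an edge is a pair of opposite arcs.
\<close>

definition complete_graph :: "nat \<Rightarrow> nat pair_pre_digraph" where
  "complete_graph n =
     \<lparr> pverts = {..<n}, parcs = {(i, j). i < n \<and> j < n \<and> i \<noteq> j} \<rparr>"

definition disjoint_copies :: "nat \<Rightarrow> 'a pair_pre_digraph \<Rightarrow> (nat \<times> 'a) pair_pre_digraph" where
  "disjoint_copies m G =
     \<lparr> pverts = {..<m} \<times> pverts G,
       parcs = {((i, u), (j, v)). i < m \<and> i = j \<and> (u, v) \<in> parcs G} \<rparr>"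

definition graph_join ::
  "'a pair_pre_digraph \<Rightarrow> 'b pair_pre_digraph \<Rightarrow> ('a + 'b) pair_pre_digraph" where
  "graph_join G H =
     \<lparr> pverts = pverts G <+> pverts H,
       parcs = {(Inl u, Inl v) | u v. (u, v) \<in> parcs G}
             \<union> {(Inr u, Inr v) | u v. (u, v) \<in> parcs H}
             \<union> {(Inl u, Inr v) | u v. u \<in> pverts G \<and> v \<in> pverts H}
             \<union> {(Inr v, Inl u) | u v. u \<in> pverts G \<and> v \<in> pverts H} \<rparr>"

definition fan_graph :: "nat \<Rightarrow> (nat + nat \<times> nat) pair_pre_digraph" where
  "fan_graph k = graph_join (complete_graph 1) (disjoint_copies k (complete_graph 2))"

text \<open>The order is \<open>n\<close> only for \<open>k \<le> n\<close>, because of truncated subtraction.\<close>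

definition complete_split_graph :: "nat \<Rightarrow> nat \<Rightarrow> (nat + nat \<times> nat) pair_pre_digraph" where
  "complete_split_graph n k =
     graph_join (complete_graph k) (disjoint_copies (n - k) (complete_graph 1))"

text \<open>The subgraph need not be induced.\<close>

definition graph_free :: "'b pair_pre_digraph \<Rightarrow> 'a pair_pre_digraph \<Rightarrow> bool" where
  "graph_free F G \<longleftrightarrow>
     \<not> (\<exists>H :: 'a pair_pre_digraph.
          subgraph (with_proj H) (with_proj G) \<and> digraph_iso (with_proj F) (with_proj H))"

text \<open>
  Matrices are indexed by \<open>{0..<n}\<close>, so the vertices are listed in an arbitrary fixed order. The
  spectrum does not depend on it: see \<open>spectrum_signless_laplacian\<close> below.
\<close>

definition vertex_enum :: "'a pair_pre_digraph \<Rightarrow> nat \<Rightarrow> 'a" where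
  "vertex_enum G = (SOME f. bij_betw f {0..<card (pverts G)} (pverts G))"

definition adjacency_matrix :: "'a pair_pre_digraph \<Rightarrow> real mat" where
  "adjacency_matrix G = mat (card (pverts G)) (card (pverts G))
     (\<lambda>(i, j). if (vertex_enum G i, vertex_enum G j) \<in> parcs G then 1 else 0)"

text \<open>By symmetry of the arc set, the degree of a vertex is its out-degree.\<close>

definition degree_matrix :: "'a pair_pre_digraph \<Rightarrow> real mat" where
  "degree_matrix G = mat (card (pverts G)) (card (pverts G))
     (\<lambda>(i, j). if i = j then real (out_degree (with_proj G) (vertex_enum G i)) else 0)"

definition signless_laplacian :: "'a pair_pre_digraph \<Rightarrow> real mat" where
  "signless_laplacian G = degree_matrix G + adjacency_matrix G"

text \<open>
  The matrix is real symmetric, so its real eigenvalues are all of its eigenvalues.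
  The maximum is only meaningful for graphs with at least one vertex.
\<close>

definition q1 :: "'a pair_pre_digraph \<Rightarrow> real" where
  "q1 G = Max (spectrum (signless_laplacian G))"

lemma pair_graphI:
  assumes "finite (pverts G)" "parcs G \<subseteq> pverts G \<times> pverts G"
    "sym (parcs G)" "irrefl (parcs G)"
  shows "pair_graph G"
proof
  show "finite (parcs G)" using assms(1,2) by (meson finite_SigmaI finite_subset)
  show "symmetric (with_proj G)" using assms(3) by (simp add: symmetric_def)
qed (use assms in \<open>auto simp: irrefl_def\<close>)

lemma pair_graphD:
  assumes "pair_graph G"
  shows "finite (pverts G)" "parcs G \<subseteq> pverts G \<times> pverts G"
    "sym (parcs G)" "irrefl (parcs G)"
proof -
  interpret pair_graph G by fact
  show "finite (pverts G)" by (rule pair_finite_verts)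
  show "parcs G \<subseteq> pverts G \<times> pverts G" using wellformed' by auto
  show "sym (parcs G)" using pair_sym_arcs by (simp add: symmetric_def)
  show "irrefl (parcs G)" using pair_no_loops by (force simp: irrefl_def)
qed

lemma pair_graph_complete_graph: "pair_graph (complete_graph n)"
  by (rule pair_graphI) (auto simp: complete_graph_def sym_def irrefl_def)

lemma pair_graph_disjoint_copies:
  assumes "pair_graph G"
  shows "pair_graph (disjoint_copies m G)"
  using pair_graphD[OF assms]
  by (intro pair_graphI) (auto simp: disjoint_copies_def sym_def irrefl_def)

lemma pair_graph_graph_join:
  assumes "pair_graph G" "pair_graph H"
  shows "pair_graph (graph_join G H)"
  using pair_graphD[OF assms(1)] pair_graphD[OF assms(2)]
  by (intro pair_graphI) (auto simp: graph_join_def sym_def irrefl_def)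

lemma pair_graph_fan_graph: "pair_graph (fan_graph k)"
  unfolding fan_graph_def
  by (intro pair_graph_graph_join pair_graph_disjoint_copies pair_graph_complete_graph)

lemma pair_graph_complete_split_graph: "pair_graph (complete_split_graph n k)"
  unfolding complete_split_graph_def
  by (intro pair_graph_graph_join pair_graph_disjoint_copies pair_graph_complete_graph)

lemma card_complete_split_graph:
  "k \<le> n \<Longrightarrow> card (pverts (complete_split_graph n k)) = n"
  by (simp add: complete_split_graph_def graph_join_def disjoint_copies_def complete_graph_def
      card_Plus card_cartesian_product)

lemma card_fan_graph: "card (pverts (fan_graph k)) = 2 * k + 1"
  by (simp add: fan_graph_def graph_join_def disjoint_copies_def complete_graph_def
      card_Plus card_cartesian_product)

lemma bij_vertex_enum:
  "finite (pverts G) \<Longrightarrow> bij_betw (vertex_enum G) {0..<card (pverts G)} (pverts G)"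
  unfolding vertex_enum_def by (rule someI_ex[OF ex_bij_betw_nat_finite])

lemma signless_laplacian_carrier:
  "signless_laplacian G \<in> carrier_mat (card (pverts G)) (card (pverts G))"
  by (simp add: signless_laplacian_def degree_matrix_def adjacency_matrix_def)

lemma finite_spectrum_signless_laplacian: "finite (spectrum (signless_laplacian G))"
  by (rule card_finite_spectrum(1)[OF signless_laplacian_carrier])

lemma spectrum_signless_laplacian:
  assumes "finite (pverts G)"
  shows "x \<in> spectrum (signless_laplacian G) \<longleftrightarrow>
    (\<exists>f. (\<exists>u\<in>pverts G. f u \<noteq> 0) \<and>
      (\<forall>u\<in>pverts G. real (out_degree (with_proj G) u) * f u
          + (\<Sum>v | v \<in> pverts G \<and> (u, v) \<in> parcs G. f v) = x * f u))"
  (is "_ \<longleftrightarrow> ?R")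
proof -
  let ?n = "card (pverts G)" and ?e = "vertex_enum G" and ?Q = "signless_laplacian G"
  have bij: "bij_betw ?e {0..<?n} (pverts G)" by (rule bij_vertex_enum[OF assms])
  have entry: "(?Q *\<^sub>v w) $ i = real (out_degree (with_proj G) (?e i)) * f (?e i)
          + (\<Sum>v | v \<in> pverts G \<and> (?e i, v) \<in> parcs G. f v)"
    if w: "w \<in> carrier_vec ?n" and i: "i < ?n" and wf: "\<And>j. j < ?n \<Longrightarrow> w $ j = f (?e j)"
    for w f i
  proof -
    have "(?Q *\<^sub>v w) $ i = (\<Sum>j\<in>{0..<?n}. ?Q $$ (i, j) * w $ j)"
      using w i signless_laplacian_carrier[of G]
      by (auto simp: scalar_prod_def intro!: sum.cong)
    also have "\<dots> = (\<Sum>j\<in>{0..<?n}.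
        (if i = j then real (out_degree (with_proj G) (?e i)) * f (?e j) else 0)
        + (if (?e i, ?e j) \<in> parcs G then f (?e j) else 0))"
      using i by (intro sum.cong)
        (auto simp: wf signless_laplacian_def degree_matrix_def adjacency_matrix_def algebra_simps)
    also have "\<dots> = real (out_degree (with_proj G) (?e i)) * f (?e i)
        + (\<Sum>j\<in>{0..<?n}. if (?e i, ?e j) \<in> parcs G then f (?e j) else 0)"
      using i by (simp add: sum.distrib)
    also have "(\<Sum>j\<in>{0..<?n}. if (?e i, ?e j) \<in> parcs G then f (?e j) else 0)
        = (\<Sum>v\<in>pverts G. if (?e i, v) \<in> parcs G then f v else 0)"
      by (rule sum.reindex_bij_betw[OF bij])
    also have "\<dots> = (\<Sum>v | v \<in> pverts G \<and> (?e i, v) \<in> parcs G. f v)"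
      using assms by (simp add: sum.inter_filter)
    finally show ?thesis .
  qed
  have all: "(\<forall>u\<in>pverts G. P u) \<longleftrightarrow> (\<forall>i<?n. P (?e i))" for P
    using bij by (force simp: bij_betw_def)
  show ?thesis
  proof
    assume "x \<in> spectrum ?Q"
    then obtain w where w: "w \<in> carrier_vec ?n" "w \<noteq> 0\<^sub>v ?n" "?Q *\<^sub>v w = x \<cdot>\<^sub>v w"
      using signless_laplacian_carrier[of G]
      by (auto simp: spectrum_def eigenvalue_def eigenvector_def)
    define f where "f u = w $ the_inv_into {0..<?n} ?e u" for u
    have wf: "w $ j = f (?e j)" if "j < ?n" for j
      using that bij by (simp add: f_def bij_betw_def the_inv_into_f_f)
    obtain j where j: "j < ?n" "w $ j \<noteq> 0" using w(1,2) by (metis carrier_vecD eq_vecI index_zero_vec)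
    have "?e j \<in> pverts G" using bij j(1) by (auto simp: bij_betw_def)
    moreover have "f (?e j) \<noteq> 0" using j wf by simp
    moreover have "\<forall>u\<in>pverts G. real (out_degree (with_proj G) u) * f u
          + (\<Sum>v | v \<in> pverts G \<and> (u, v) \<in> parcs G. f v) = x * f u"
      unfolding all using entry[OF w(1) _ wf] w(1,3) wf by fastforce
    ultimately show ?R by blast
  next
    assume ?R
    then obtain f where f: "\<exists>u\<in>pverts G. f u \<noteq> 0"
      "\<forall>u\<in>pverts G. real (out_degree (with_proj G) u) * f u
          + (\<Sum>v | v \<in> pverts G \<and> (u, v) \<in> parcs G. f v) = x * f u" by blast
    define w where "w = vec ?n (\<lambda>i. f (?e i))"
    have w: "w \<in> carrier_vec ?n" by (simp add: w_def)
    have "\<exists>i<?n. f (?e i) \<noteq> 0" using f(1) all[of "\<lambda>u. f u = 0"] by blast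
    then have "w \<noteq> 0\<^sub>v ?n" by (metis index_vec index_zero_vec(1) w_def)
    moreover have "?Q *\<^sub>v w = x \<cdot>\<^sub>v w"
    proof (rule eq_vecI)
      fix i assume "i < dim_vec (x \<cdot>\<^sub>v w)"
      then have i: "i < ?n" by (simp add: w_def)
      then show "(?Q *\<^sub>v w) $ i = (x \<cdot>\<^sub>v w) $ i"
        using f(2)[unfolded all] entry[OF w i, of f] by (simp add: w_def)
    qed (use signless_laplacian_carrier[of G] in \<open>auto simp: w_def\<close>)
    ultimately show "x \<in> spectrum ?Q"
      using w signless_laplacian_carrier[of G]
      by (auto simp: spectrum_def eigenvalue_def eigenvector_def)
  qed
qed

end

theory Submission
  imports Defs
begin

text \<open>
  Let \<open>q\<close> be the larger root of \<open>x\<^sup>2 - (n + 2 * k - 2) * x + 2 * k * (k - 1)\<close>, which is an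
  eigenvalue of \<open>S\<close>, the complete split graph. Suppose that \<open>lam = q1 G \<ge> q\<close>, and let \<open>y\<close> be the
  absolute value of an eigenvector. By Merris' bound some vertex \<open>v\<close> satisfies
  \<open>d(v) + m(v) \<ge> q\<close>, where \<open>m(v)\<close> is the average degree of its neighbours. As \<open>n + 2 * k - 3 < q\<close>,
  the neighbourhood \<open>N\<close> of \<open>v\<close> spans many edges and almost all pairs between \<open>N\<close> and the vertices
  outside are adjacent. The graph on \<open>N\<close> has no matching of size \<open>k\<close>, so \<open>N\<close> is the
  union of a set \<open>T\<close> of \<open>k - 1\<close> vertices and an independent set \<open>I\<close>. At least \<open>k\<close> vertices of \<open>I\<close>
  are adjacent to all of \<open>B = V - I\<close>, and therefore, \<open>G\<close> being fan-free, \<open>B\<close> induces maximum degree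
  at most \<open>k - 1\<close>. At the largest entry of \<open>y\<close> on \<open>B\<close> this gives
  \<open>lam\<^sup>2 - (n + 2 * k - 2) * lam + 2 * (k - 1) * |B| \<le> 0\<close>. Since \<open>|B| \<ge> k\<close> and
  \<open>lam \<ge> q\<close>, equality holds throughout, so that \<open>G\<close> is \<open>S\<close>.
\<close>

section \<open>Degrees and matchings\<close>

text \<open>The set \<open>S\<close> is a parameter so that degrees into parts of the vertex set can
  be counted. With \<open>- E\<close> in place of \<open>E\<close> the same function counts
  non-neighbours; in the estimates below \<open>u\<close> then lies outside \<open>S\<close>, so the
  pair \<open>(u, u)\<close> is not counted.\<close>

definition nbhd :: "('a \<times> 'a) set \<Rightarrow> 'a set \<Rightarrow> 'a \<Rightarrow> 'a set" where
  "nbhd E S u = {v \<in> S. (u, v) \<in> E}"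

abbreviation deg :: "('a \<times> 'a) set \<Rightarrow> 'a set \<Rightarrow> 'a \<Rightarrow> nat" where
  "deg E S u \<equiv> card (nbhd E S u)"

lemma nbhd_subset: "nbhd E S u \<subseteq> S"
  by (auto simp: nbhd_def)

lemma finite_nbhd [simp]: "finite S \<Longrightarrow> finite (nbhd E S u)"
  by (simp add: nbhd_def)

lemma in_nbhd_iff: "v \<in> nbhd E S u \<longleftrightarrow> v \<in> S \<and> (u, v) \<in> E"
  by (simp add: nbhd_def)

lemma deg_le_card: "finite S \<Longrightarrow> deg E S u \<le> card S"
  by (simp add: card_mono nbhd_subset)

lemma deg_le_card_minus_one:
  assumes "finite S" "irrefl E" "u \<in> S"
  shows "deg E S u \<le> card S - 1"
proof -
  have "nbhd E S u \<subseteq> S - {u}"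
    using assms(2) by (auto simp: nbhd_def irrefl_def)
  then have "deg E S u \<le> card (S - {u})"
    using assms(1) by (simp add: card_mono)
  then show ?thesis using assms by simp
qed

lemma nbhd_Un: "nbhd E (S \<union> T) u = nbhd E S u \<union> nbhd E T u"
  by (auto simp: nbhd_def)

lemma deg_Un_disjoint:
  assumes "finite S" "finite T" "S \<inter> T = {}"
  shows "deg E (S \<union> T) u = deg E S u + deg E T u"
  unfolding nbhd_Un using assms nbhd_subset[of E] by (intro card_Un_disjoint) (auto simp: nbhd_def)

lemma sum_deg_swap:
  assumes "finite S" "finite T" "sym E"
  shows "(\<Sum>u\<in>S. deg E T u) = (\<Sum>v\<in>T. deg E S v)"
proof -
  have eq: "nbhd E S v = {u \<in> S. (u, v) \<in> E}" for v
    using assms(3) by (auto simp: nbhd_def sym_def)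
  show ?thesis
    using sum_multicount_gen[of S T "\<lambda>u v. (u, v) \<in> E" "deg E S"] assms(1,2)
    by (simp add: eq) (simp add: nbhd_def)
qed

text \<open>Each edge is represented by one of its two arcs: distinct members have disjoint ends, so
  opposite arcs cannot both occur and \<open>card M\<close> counts edges.\<close>

definition matching :: "('a \<times> 'a) set \<Rightarrow> 'a set \<Rightarrow> ('a \<times> 'a) set \<Rightarrow> bool" where
  "matching E S M \<longleftrightarrow> M \<subseteq> E \<inter> S \<times> S \<and>
     (\<forall>p\<in>M. \<forall>q\<in>M. p \<noteq> q \<longrightarrow> {fst p, snd p} \<inter> {fst q, snd q} = {})"

definition covered :: "('a \<times> 'a) set \<Rightarrow> 'a set" where
  "covered M = fst ` M \<union> snd ` M"

lemma matching_empty: "matching E S {}"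
  by (simp add: matching_def)

lemma finite_matching: "finite S \<Longrightarrow> matching E S M \<Longrightarrow> finite M"
  unfolding matching_def by (meson finite_SigmaI finite_subset le_inf_iff)

lemma covered_subset: "matching E S M \<Longrightarrow> covered M \<subseteq> S"
  by (auto simp: matching_def covered_def)

lemma covered_insert: "covered (insert (a, b) M) = {a, b} \<union> covered M"
  by (auto simp: covered_def)

lemma matching_insert:
  assumes "matching E S M" "a \<in> S" "b \<in> S" "(a, b) \<in> E" "a \<notin> covered M" "b \<notin> covered M"
  shows "matching E S (insert (a, b) M)"
proof -
  have disj: "{fst p, snd p} \<inter> {a, b} = {}" if "p \<in> M" for p
  proof -
    have "fst p \<in> covered M" "snd p \<in> covered M" using that by (auto simp: covered_def)
    then show ?thesis using assms(5,6) by auto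
  qed
  have M: "M \<subseteq> E \<inter> S \<times> S"
    "\<And>p q. p \<in> M \<Longrightarrow> q \<in> M \<Longrightarrow> p \<noteq> q \<Longrightarrow> {fst p, snd p} \<inter> {fst q, snd q} = {}"
    using assms(1) unfolding matching_def by blast+
  show ?thesis
    unfolding matching_def
  proof (intro conjI ballI impI)
    show "insert (a, b) M \<subseteq> E \<inter> S \<times> S" using M(1) assms(2-4) by simp
    fix p q assume pq: "p \<in> insert (a, b) M" "q \<in> insert (a, b) M" "p \<noteq> q"
    consider "p = (a, b)" "q \<in> M" | "q = (a, b)" "p \<in> M" | "p \<in> M" "q \<in> M" using pq by blast
    then show "{fst p, snd p} \<inter> {fst q, snd q} = {}"
    proof cases
      case 1
      then show ?thesis using disj[of q] by (simp add: Int_commute)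
    next
      case 2
      then show ?thesis using disj[of p] by simp
    qed (rule M(2)[OF _ _ pq(3)])
  qed
qed

lemma notin_matching: "a \<notin> covered M \<Longrightarrow> (a, b) \<notin> M"
  by (metis UnI1 covered_def fst_conv imageI)

lemma matching_remove: "matching E S M \<Longrightarrow> matching E S (M - {p})"
  by (auto simp: matching_def)

lemma covered_remove:
  assumes "matching E S M" "(x, y) \<in> M"
  shows "covered (M - {(x, y)}) = covered M - {x, y}"
proof -
  have "{fst p, snd p} \<inter> {x, y} = {}" if "p \<in> M" "p \<noteq> (x, y)" for p
  proof -
    have "{fst p, snd p} \<inter> {fst (x, y), snd (x, y)} = {}"
      using assms that unfolding matching_def by blast
    then show ?thesis by simp
  qed
  then have "covered (M - {(x, y)}) \<inter> {x, y} = {}"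
    unfolding covered_def by blast
  moreover have "covered M = {x, y} \<union> covered (M - {(x, y)})"
    using assms(2) covered_insert[of x y "M - {(x, y)}"] by (simp add: insert_absorb)
  ultimately show ?thesis by blast
qed

lemma inj_on_fst_matching: "matching E S M \<Longrightarrow> inj_on fst M"
  unfolding matching_def by (intro inj_onI) blast

lemma inj_on_snd_matching: "matching E S M \<Longrightarrow> inj_on snd M"
  unfolding matching_def by (intro inj_onI) blast

lemma fst_snd_disjoint_matching:
  assumes "matching E S M" "irrefl E"
  shows "fst ` M \<inter> snd ` M = {}"
proof -
  have "fst p \<noteq> snd q" if "p \<in> M" "q \<in> M" for p q
  proof (cases "p = q")
    case True
    then show ?thesis
      using assms that by (cases p) (auto simp: matching_def irrefl_def)
  next
    case False
    then have "{fst p, snd p} \<inter> {fst q, snd q} = {}"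
      using assms(1) that unfolding matching_def by blast
    then show ?thesis by auto
  qed
  then show ?thesis by auto
qed

lemma sum_covered:
  fixes g :: "'a \<Rightarrow> 'b::comm_monoid_add"
  assumes "finite S" "matching E S M" "irrefl E"
  shows "(\<Sum>u\<in>covered M. g u) = (\<Sum>p\<in>M. g (fst p) + g (snd p))"
proof -
  have "(\<Sum>u\<in>covered M. g u) = (\<Sum>u\<in>fst ` M. g u) + (\<Sum>u\<in>snd ` M. g u)"
    unfolding covered_def
    using finite_matching[OF assms(1,2)] fst_snd_disjoint_matching[OF assms(2,3)]
    by (intro sum.union_disjoint) auto
  also have "\<dots> = (\<Sum>p\<in>M. g (fst p)) + (\<Sum>p\<in>M. g (snd p))"
    using inj_on_fst_matching[OF assms(2)] inj_on_snd_matching[OF assms(2)]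
    by (simp add: sum.reindex)
  finally show ?thesis by (simp add: sum.distrib)
qed

lemma card_covered:
  assumes "finite S" "matching E S M" "irrefl E"
  shows "card (covered M) = 2 * card M"
  using sum_covered[OF assms, of "\<lambda>_. 1::nat"] by simp

text \<open>Any bijection between \<open>k\<close> vertices of \<open>A\<close> and \<open>k\<close>
  vertices of \<open>B\<close> is a matching. Inside a neighbourhood it yields a fan.\<close>

lemma matching_bipartite:
  assumes "A \<subseteq> S" "B \<subseteq> S" "A \<inter> B = {}" "A \<times> B \<subseteq> E" "k \<le> card A" "k \<le> card B"
  shows "\<exists>M. matching E S M \<and> card M = k"
proof -
  obtain A' where A': "A' \<subseteq> A" "card A' = k" "finite A'"
    using obtain_subset_with_card_n[OF assms(5)] by auto
  obtain B' where B': "B' \<subseteq> B" "card B' = k" "finite B'"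
    using obtain_subset_with_card_n[OF assms(6)] by auto
  obtain h where h: "bij_betw h A' B'"
    using A' B' by (metis finite_same_card_bij)
  let ?M = "(\<lambda>a. (a, h a)) ` A'"
  have hB: "h a \<in> B'" if "a \<in> A'" for a
    using h that by (auto simp: bij_betw_def)
  have "matching E S ?M"
    unfolding matching_def
  proof (intro conjI ballI impI)
    show "?M \<subseteq> E \<inter> S \<times> S"
      using hB A' B' assms by blast
  next
    fix p q assume "p \<in> ?M" "q \<in> ?M" "p \<noteq> q"
    then obtain a b where ab: "p = (a, h a)" "q = (b, h b)" "a \<in> A'" "b \<in> A'" "a \<noteq> b" by auto
    then have "h a \<noteq> h b" using h by (auto simp: bij_betw_def inj_on_def)
    moreover have "a \<noteq> h b" "h a \<noteq> b" using ab hB A'(1) B'(1) assms(3) by blast+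
    ultimately show "{fst p, snd p} \<inter> {fst q, snd q} = {}" using ab by auto
  qed
  moreover have "card ?M = k" using A' by (subst card_image) (auto simp: inj_on_def)
  ultimately show ?thesis by blast
qed

text \<open>
  In a maximum matching, two distinct uncovered vertices adjacent to the two ends of a matching edge
  would allow an augmentation. So each matching edge sends few edges to the uncovered set, unless
  exactly one of its ends does; the density rules out the former, and these ends form the cover.
\<close>

lemma dense_matching_bounded_cover:
  fixes k :: nat
  assumes fin: "finite N" and symE: "sym E" and irr: "irrefl E"
    and bound: "\<And>M. matching E N M \<Longrightarrow> card M < k"
    and d: "2 * k \<le> card N"
    and dense: "2 * (int k - 1) * (int (card N) - 1) - 2 * (int (card N) - 2 * int k)
                 < int (\<Sum>u\<in>N. deg E N u)"
  shows "\<exists>T\<subseteq>N. card T = k - 1 \<and> (\<forall>a\<in>N - T. \<forall>b\<in>N - T. (a, b) \<notin> E)"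
proof -
  have "\<exists>M. matching E N M \<and> (\<forall>M'. matching E N M' \<longrightarrow> card M' \<le> card M)"
  proof -
    have "\<exists>M. matching E N M" using matching_empty by blast
    then show ?thesis
      using ex_has_greatest_nat[of "matching E N" _ card k] bound by (metis less_imp_le)
  qed
  then obtain M where M: "matching E N M" and max: "\<And>M'. matching E N M' \<Longrightarrow> card M' \<le> card M"
    by blast
  define U where "U = covered M"
  define R where "R = N - U"
  define m where "m = card M"
  have finM: "finite M" using finite_matching[OF fin M] .
  have UN: "U \<subseteq> N" using covered_subset[OF M] by (simp add: U_def)
  have cU: "card U = 2 * m" using card_covered[OF fin M irr] by (simp add: U_def m_def)
  have finU: "finite U" and finR: "finite R" using UN fin finite_subset by (auto simp: R_def)
  have mk: "m < k" using bound[OF M] by (simp add: m_def)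
  have cR: "card R = card N - 2 * m" using cU UN finU by (simp add: R_def card_Diff_subset)
  have cR2: "2 \<le> card R" using cR d mk by linarith
  have NUR: "N = U \<union> R" "U \<inter> R = {}" using UN by (auto simp: R_def)
  have Rind: "(a, b) \<notin> E" if "a \<in> R" "b \<in> R" for a b
  proof
    assume "(a, b) \<in> E"
    then have "matching E N (insert (a, b) M)"
      using that by (intro matching_insert M) (auto simp: R_def U_def)
    from max[OF this] show False
      using that notin_matching[of a M b] finM by (simp add: R_def U_def)
  qed
  have loopless: "fst p \<noteq> snd p" if "p \<in> M" for p
  proof -
    have "p \<in> E" using M that by (auto simp: matching_def)
    then show ?thesis using irr by (cases p) (auto simp: irrefl_def)
  qed
  \<comment> \<open>Otherwise the path \<open>a\<close>, \<open>x\<close>, \<open>y\<close>,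
    \<open>b\<close> is augmenting: replacing \<open>(x, y)\<close> by \<open>(x, a)\<close> and
    \<open>(y, b)\<close> gives a larger matching.\<close>
  have exch: "a = b" if "(x, y) \<in> M" "a \<in> nbhd E R x" "b \<in> nbhd E R y" for x y a b
  proof (rule ccontr)
    assume ab: "a \<noteq> b"
    define M1 where "M1 = M - {(x, y)}"
    have xy: "x \<in> U" "y \<in> U" "x \<noteq> y"
      using loopless[OF that(1)] that(1) by (auto simp: U_def covered_def image_iff intro: bexI[of _ "(x, y)"])
    have cov: "covered M1 = U - {x, y}"
      unfolding M1_def U_def by (rule covered_remove[OF M that(1)])
    have aR: "a \<in> R" "(x, a) \<in> E" and bR: "b \<in> R" "(y, b) \<in> E"
      using that(2,3) by (auto simp: in_nbhd_iff)
    have m1: "matching E N (insert (x, a) M1)"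
      using aR xy UN cov matching_remove[OF M]
      by (intro matching_insert) (auto simp: M1_def R_def)
    have cov1: "covered (insert (x, a) M1) = {x, a} \<union> (U - {x, y})"
      by (simp add: covered_insert cov)
    have m2: "matching E N (insert (y, b) (insert (x, a) M1))"
      by (rule matching_insert[OF m1]) (use aR bR xy UN ab cov1 in \<open>auto simp: R_def\<close>)
    have "(y, b) \<notin> insert (x, a) M1"
      using cov1 xy aR by (intro notin_matching) (auto simp: R_def)
    moreover have "(x, a) \<notin> M1" using cov by (intro notin_matching) auto
    moreover have "card M1 = card M - 1" "card M > 0"
      using that(1) finM by (auto simp: M1_def card_gt_0_iff)
    moreover have "finite M1" using finM by (simp add: M1_def)
    ultimately have "card (insert (y, b) (insert (x, a) M1)) = card M + 1" by simp
    with max[OF m2] show False by simp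
  qed
  define c where "c p = deg E R (fst p) + deg E R (snd p)" for p
  \<comment> \<open>Arcs inside \<open>U\<close> are bounded trivially, there are none inside
    \<open>R\<close>, and every edge between \<open>U\<close> and \<open>R\<close> counts
    twice.\<close>
  have e2: "(\<Sum>u\<in>N. deg E N u) \<le> 2 * m * (2 * m - 1) + 2 * (\<Sum>p\<in>M. c p)"
  proof -
    have dN: "deg E N u = deg E U u + deg E R u" for u
      unfolding NUR(1) by (rule deg_Un_disjoint[OF finU finR NUR(2)])
    have R0: "deg E R u = 0" if "u \<in> R" for u
    proof -
      have "nbhd E R u = {}" using Rind that by (auto simp: nbhd_def)
      then show ?thesis by simp
    qed
    have "(\<Sum>u\<in>N. deg E N u) = (\<Sum>u\<in>U. deg E N u) + (\<Sum>u\<in>R. deg E N u)"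
      using sum.union_disjoint[OF finU finR NUR(2), of "deg E N"] unfolding NUR(1)[symmetric] .
    also have "\<dots> = (\<Sum>u\<in>U. deg E U u) + (\<Sum>u\<in>U. deg E R u) + (\<Sum>u\<in>R. deg E U u)"
      by (simp add: dN R0 sum.distrib)
    also have "(\<Sum>u\<in>R. deg E U u) = (\<Sum>u\<in>U. deg E R u)"
      by (rule sum_deg_swap[OF finR finU symE])
    also have "(\<Sum>u\<in>U. deg E R u) = (\<Sum>p\<in>M. c p)"
      unfolding U_def c_def by (rule sum_covered[OF fin M irr])
    also have "(\<Sum>u\<in>U. deg E U u) \<le> card U * (2 * m - 1)"
      using deg_le_card_minus_one[OF finU irr] cU by (intro sum_bounded_above[THEN order_trans]) auto
    finally show ?thesis by (simp add: cU)
  qed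
  have c_small: "c p \<le> 2" if "p \<in> M" "deg E R (fst p) < 2" "deg E R (snd p) < 2" for p
    using that by (simp add: c_def)
  \<comment> \<open>If both ends have uncovered neighbours, \<open>exch\<close> forces these to be
    one common vertex, so \<open>c p\<close> is at most 2, which \<open>cR2\<close> allows.\<close>
  have c_le: "c p \<le> card R" if "p \<in> M" for p
  proof (cases "nbhd E R (fst p) = {} \<or> nbhd E R (snd p) = {}")
    case True
    then show ?thesis
      using deg_le_card[OF finR, of E "fst p"] deg_le_card[OF finR, of E "snd p"] by (auto simp: c_def)
  next
    case False
    then obtain a b where ab: "a \<in> nbhd E R (fst p)" "b \<in> nbhd E R (snd p)" by blast
    have "nbhd E R (fst p) \<subseteq> {b}" "nbhd E R (snd p) \<subseteq> {a}"
      using exch[of "fst p" "snd p"] that ab by auto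
    then have "deg E R (fst p) \<le> 1" "deg E R (snd p) \<le> 1"
      by (metis card_mono finite.intros is_singletonI is_singleton_altdef)+
    then show ?thesis using cR2 by (simp add: c_def)
  qed
  have sum_c: "(\<Sum>p\<in>M. c p) \<le> m * card R"
    using c_le unfolding m_def by (metis (no_types, lifting) of_nat_id sum_bounded_above)
  have nN: "int (card N) = int (card R) + 2 * int m" using cR d mk by linarith
  \<comment> \<open>The bound \<open>2 * m * (card N - 1)\<close> on the number of arcs is too small
    as soon as \<open>m\<close> is at most \<open>k - 2\<close>.\<close>
  have m_eq: "m = k - 1"
  proof (rule ccontr)
    assume "m \<noteq> k - 1"
    then have le: "int m \<le> int k - 2" using mk by linarith
    have "int (\<Sum>u\<in>N. deg E N u) \<le> int (2 * m * (2 * m - 1) + 2 * (m * card R))"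
      using e2 sum_c by linarith
    also have "\<dots> = 2 * int m * (int (card N) - 1)"
      by (cases m) (simp_all add: nN algebra_simps)
    also have "\<dots> \<le> 2 * (int k - 2) * (int (card N) - 1)"
      using le d mk by (intro mult_right_mono) auto
    also have "\<dots> = 2 * (int k - 1) * (int (card N) - 1) - 2 * (int (card N) - 1)"
      by (simp add: algebra_simps)
    finally have "int (\<Sum>u\<in>N. deg E N u)
        \<le> 2 * (int k - 1) * (int (card N) - 1) - 2 * (int (card N) - 1)" .
    moreover have "int (card N) - 1 \<ge> int (card N) - 2 * int k" using mk by simp
    moreover have "False" if "s \<le> X - 2 * a" "b \<le> a" "X - 2 * b < s" for s X a b :: int
      using that by linarith
    ultimately show False using dense by blast
  qed
  \<comment> \<open>A matching edge violating this contributes at most 2 instead of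
    \<open>card R\<close>. For \<open>m = k - 1\<close> the resulting bound on the number of arcs is
    exactly the left side of \<open>dense\<close>.\<close>
  have big: "2 \<le> deg E R (fst p) \<or> 2 \<le> deg E R (snd p)" if "p \<in> M" for p
  proof (rule ccontr)
    assume "\<not> ?thesis"
    then have "c p \<le> 2" using c_small[OF that] by simp
    moreover have "(\<Sum>q\<in>M. c q) = c p + (\<Sum>q\<in>M - {p}. c q)"
      by (rule sum.remove[OF finM that])
    moreover have "(\<Sum>q\<in>M - {p}. c q) \<le> card (M - {p}) * card R"
      using sum_bounded_above[of "M - {p}" c "card R"] c_le by simp
    moreover have "card (M - {p}) = m - 1" using that finM by (simp add: m_def)
    ultimately have "(\<Sum>q\<in>M. c q) \<le> 2 + (m - 1) * card R" by simp
    then have "(\<Sum>u\<in>N. deg E N u) \<le> 2 * m * (2 * m - 1) + 2 * (2 + (m - 1) * card R)"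
      by (intro order_trans[OF e2]) simp
    then have "int (\<Sum>u\<in>N. deg E N u) \<le> int (2 * m * (2 * m - 1) + 2 * (2 + (m - 1) * card R))"
      by (rule of_nat_mono)
    moreover have "m > 0" using that finM by (auto simp: m_def card_gt_0_iff)
    then have "int (2 * m * (2 * m - 1) + 2 * (2 + (m - 1) * card R))
        = 2 * int m * (int (card N) - 1) - 2 * (int (card N) - 2 * int m) + 4"
      by (cases m) (simp_all add: nN algebra_simps)
    moreover have "int k - 1 = int m" using m_eq mk by linarith
    ultimately show False using dense by simp
  qed
  \<comment> \<open>\<open>t p\<close> is an end with at least two uncovered neighbours and goes
    into the cover; \<open>z p\<close> is the other end.\<close>
  define t z where "t p = (if 2 \<le> deg E R (fst p) then fst p else snd p)"
    and "z p = (if 2 \<le> deg E R (fst p) then snd p else fst p)" for p :: "'a \<times> 'a"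
  have tz: "(t p, z p) \<in> M \<or> (z p, t p) \<in> M" if "p \<in> M" for p
    using that by (cases p) (auto simp: t_def z_def)
  have t2: "2 \<le> deg E R (t p)" if "p \<in> M" for p
    using big[OF that] by (auto simp: t_def)
  have tzU: "{t p, z p} = {fst p, snd p}" for p by (auto simp: t_def z_def)
  have t_other: "\<exists>a\<in>nbhd E R (t p). a \<noteq> b" if "p \<in> M" for p b
  proof (rule ccontr)
    assume "\<not> ?thesis"
    then have "nbhd E R (t p) \<subseteq> {b}" by blast
    then have "deg E R (t p) \<le> card {b}" by (intro card_mono) auto
    then show False using t2[OF that] by simp
  qed
  have zR: "(z p, b) \<notin> E" if pM: "p \<in> M" and bR: "b \<in> R" for p b
  proof
    assume "(z p, b) \<in> E"
    then have b: "b \<in> nbhd E R (z p)" using bR by (simp add: in_nbhd_iff)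
    obtain a where "a \<in> nbhd E R (t p)" "a \<noteq> b" using t_other[OF pM] by blast
    then show False using exch[OF _ _ b] exch[OF _ b] tz[OF pM] by blast
  qed
  \<comment> \<open>Otherwise \<open>a\<close>, \<open>t p\<close>, \<open>z p\<close>,
    \<open>z q\<close>, \<open>t q\<close>, \<open>b\<close> is an augmenting path: two matching
    edges are exchanged for three.\<close>
  have zz: "(z p, z q) \<notin> E" if pM: "p \<in> M" and qM: "q \<in> M" for p q
  proof
    assume E: "(z p, z q) \<in> E"
    then have pq: "p \<noteq> q" using irr by (auto simp: irrefl_def)
    obtain a where a: "a \<in> nbhd E R (t p)" using t_other[OF pM] by blast
    obtain b where b: "b \<in> nbhd E R (t q)" "b \<noteq> a" using t_other[OF qM] by blast
    define M1 where "M1 = M - {p} - {q}"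
    have disj: "{fst p, snd p} \<inter> {fst q, snd q} = {}"
      using M pM qM pq unfolding matching_def by blast
    have neq: "t p \<noteq> z p" "t q \<noteq> z q"
      using loopless[OF pM] loopless[OF qM] by (simp_all add: t_def z_def)
    have inU: "t p \<in> U" "z p \<in> U" "t q \<in> U" "z q \<in> U"
      using that by (auto simp: t_def z_def U_def covered_def)
    have disj': "t p \<noteq> t q" "t p \<noteq> z q" "z p \<noteq> t q" "z p \<noteq> z q"
      using disj unfolding tzU[symmetric] by blast+
    have M1: "matching E N M1" unfolding M1_def by (intro matching_remove M)
    have cov: "covered M1 = U - {t p, z p} - {t q, z q}"
      unfolding M1_def U_def tzU
      using covered_remove[OF M, of "fst p" "snd p"]
        covered_remove[OF matching_remove[OF M, of p], of "fst q" "snd q"] that pq by simp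
    have aR: "a \<in> R" "(t p, a) \<in> E" and bR: "b \<in> R" "(t q, b) \<in> E"
      using a b by (auto simp: in_nbhd_iff)
    have m1: "matching E N (insert (z p, z q) M1)"
      by (rule matching_insert[OF M1]) (use inU UN E in \<open>auto simp: cov\<close>)
    have c1: "covered (insert (z p, z q) M1) = {z p, z q} \<union> (U - {t p, z p} - {t q, z q})"
      by (simp add: covered_insert cov)
    have m2: "matching E N (insert (t p, a) (insert (z p, z q) M1))"
      by (rule matching_insert[OF m1]) (use inU UN aR neq disj' in \<open>auto simp: c1 R_def\<close>)
    have c2: "covered (insert (t p, a) (insert (z p, z q) M1))
        = {t p, a} \<union> ({z p, z q} \<union> (U - {t p, z p} - {t q, z q}))"
      by (simp add: covered_insert cov)
    have m3: "matching E N (insert (t q, b) (insert (t p, a) (insert (z p, z q) M1)))"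
      by (rule matching_insert[OF m2]) (use inU UN aR bR neq b(2) disj' in \<open>auto simp: c2 R_def\<close>)
    have "(t q, b) \<notin> insert (t p, a) (insert (z p, z q) M1)"
      by (rule notin_matching) (use neq disj' inU aR in \<open>auto simp: covered_insert cov R_def\<close>)
    moreover have "(t p, a) \<notin> insert (z p, z q) M1"
      by (rule notin_matching) (use neq disj' in \<open>simp add: c1\<close>)
    moreover have "(z p, z q) \<notin> M1"
      by (rule notin_matching) (simp add: cov)
    moreover have "card M1 + 2 = card M"
    proof -
      have "card {p, q} = 2" using pq by simp
      moreover have "M1 = M - {p, q}" by (auto simp: M1_def)
      moreover have "card {p, q} \<le> card M" using that finM by (intro card_mono) auto
      ultimately show ?thesis using that finM by (simp add: card_Diff_subset)
    qed
    moreover have "finite M1" using finM by (simp add: M1_def)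
    ultimately have "card (insert (t q, b) (insert (t p, a) (insert (z p, z q) M1))) = card M + 1"
      by simp
    with max[OF m3] show False by simp
  qed
  have inj: "inj_on t M"
  proof (rule inj_onI)
    fix p q assume pq: "p \<in> M" "q \<in> M" "t p = t q"
    show "p = q"
    proof (rule ccontr)
      assume "p \<noteq> q"
      then have "{fst p, snd p} \<inter> {fst q, snd q} = {}"
        using M pq unfolding matching_def by blast
      then show False using pq(3) tzU[of p] tzU[of q] by blast
    qed
  qed
  have rest: "N - t ` M \<subseteq> R \<union> z ` M"
  proof
    fix u assume u: "u \<in> N - t ` M"
    show "u \<in> R \<union> z ` M"
    proof (cases "u \<in> U")
      case True
      then obtain p where "p \<in> M" "u \<in> {fst p, snd p}" by (auto simp: U_def covered_def)
      then show ?thesis using u tzU[of p] by blast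
    qed (use u in \<open>auto simp: R_def\<close>)
  qed
  show ?thesis
  proof (intro exI conjI ballI)
    have "t p \<in> U" if "p \<in> M" for p using that by (auto simp: t_def U_def covered_def)
    then show "t ` M \<subseteq> N" using UN by blast
    show "card (t ` M) = k - 1" using inj m_eq by (simp add: card_image m_def)
    fix a b assume "a \<in> N - t ` M" "b \<in> N - t ` M"
    then have "a \<in> R \<union> z ` M" "b \<in> R \<union> z ` M" using rest by auto
    then show "(a, b) \<notin> E"
      using Rind zR zz symD[OF symE, of a b] by blast
  qed
qed

section \<open>Neighbourhoods in fan-free graphs\<close>

lemma deg_add_deg_Compl:
  assumes "finite S"
  shows "deg E S u + deg (- E) S u = card S"
proof -
  have "card S = card (nbhd E S u \<union> nbhd (- E) S u)"
    by (rule arg_cong[of _ _ card]) (auto simp: nbhd_def)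
  also have "\<dots> = deg E S u + deg (- E) S u"
    using assms by (intro card_Un_disjoint) (auto simp: nbhd_def)
  finally show ?thesis by simp
qed

text \<open>A union bound: a vertex of \<open>S\<close> outside the common neighbourhood is a
  non-neighbour of some \<open>a\<close> in \<open>A\<close>.\<close>

lemma card_le_common_nbhd:
  assumes "finite A" "finite S"
  shows "card S \<le> card {b \<in> S. \<forall>a\<in>A. (a, b) \<in> E} + (\<Sum>a\<in>A. deg (- E) S a)"
proof -
  let ?C = "{b \<in> S. \<forall>a\<in>A. (a, b) \<in> E}"
  have "S \<subseteq> ?C \<union> (\<Union>a\<in>A. nbhd (- E) S a)"
    by (auto simp: nbhd_def)
  then have "card S \<le> card (?C \<union> (\<Union>a\<in>A. nbhd (- E) S a))"
    using assms by (intro card_mono) auto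
  also have "\<dots> \<le> card ?C + card (\<Union>a\<in>A. nbhd (- E) S a)"
    by (rule card_Un_le)
  also have "card (\<Union>a\<in>A. nbhd (- E) S a) \<le> (\<Sum>a\<in>A. deg (- E) S a)"
    using assms(1) by (rule card_UN_le)
  finally show ?thesis by simp
qed


text \<open>
  The hypothesis \<open>ineq\<close> is Merris' bound at \<open>v\<close>, where \<open>card V + 2 * k - 2 - s\<close> plays the role of
  \<open>q\<^sub>1\<close>. If \<open>W\<close> is the set of non-neighbours of \<open>v\<close>, it also bounds the number \<open>eb\<close> of non-adjacent
  pairs between the neighbours of \<open>v\<close> and \<open>W\<close>, so that many vertices are adjacent to everything on
  the other side and any excess of edges completes to a fan.
\<close>

lemma fan_free_join_structure:
  fixes V :: "'a set" and k :: nat and s :: real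
  assumes fin: "finite V" and symE: "sym E" and irr: "irrefl E"
    and k2: "2 \<le> k" and n: "3 * (real k)\<^sup>2 - real k - 2 \<le> real (card V)"
    and nofan: "\<And>u M. u \<in> V \<Longrightarrow> matching E (nbhd E V u) M \<Longrightarrow> card M < k"
    and s: "0 < s" "s < 1"
    and vV: "v \<in> V" and d0: "0 < deg E V v"
    and ineq: "real (deg E V v) * (2 * real k - 2 - s)
      \<le> real (\<Sum>u\<in>nbhd E V v. deg E (nbhd E V v) u)
        - real (\<Sum>u\<in>nbhd E V v. deg (- E) (V - nbhd E V v - {v}) u)"
  shows "\<exists>I\<subseteq>V. (\<forall>i\<in>I. \<forall>j\<in>I. (i, j) \<notin> E) \<and> k \<le> card (V - I) \<and>
    (\<forall>u\<in>V - I. deg E (V - I) u < k)"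
proof -
  define N where "N = nbhd E V v"
  define W where "W = V - N - {v}"
  define d where "d = card N"
  define e2 where "e2 = (\<Sum>u\<in>N. deg E N u)"
  define eb where "eb = (\<Sum>u\<in>N. deg (- E) W u)"
  define K D where "K = real k" and "D = real d"
  have NV: "N \<subseteq> V" by (simp add: N_def nbhd_subset)
  have vN: "v \<notin> N" using irr by (auto simp: N_def nbhd_def irrefl_def)
  have finN: "finite N" and finW: "finite W" using NV fin finite_subset by (auto simp: W_def)
  have symEc: "sym (- E)" using symE by (auto simp: sym_def)
  have K2: "2 \<le> K" using k2 by (simp add: K_def)
  have D0: "0 < D" using d0 by (simp add: D_def d_def N_def)
  have ineq': "D * (2 * K - 2 - s) \<le> real e2 - real eb"
    using ineq by (simp add: D_def K_def d_def e2_def eb_def N_def W_def)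
  have cW: "real (card V) = D + 1 + real (card W)"
  proof -
    have "V = insert v (N \<union> W)" using vV NV by (auto simp: W_def)
    then have "card V = card (insert v (N \<union> W))" by simp
    also have "\<dots> = 1 + card (N \<union> W)" using vN finN finW by (simp add: W_def)
    also have "card (N \<union> W) = card N + card W"
      using finN finW by (intro card_Un_disjoint) (auto simp: W_def)
    finally show ?thesis by (simp add: D_def d_def)
  qed
  have fan: False if uV: "u \<in> V" and AC: "A \<subseteq> nbhd E V u" "C \<subseteq> nbhd E V u" "A \<inter> C = {}" "A \<times> C \<subseteq> E"
      "k \<le> card A" "k \<le> card C" for u A C
  proof -
    obtain M where "matching E (nbhd E V u) M" "card M = k"
      using matching_bipartite[OF AC] by blast
    with nofan[OF uV, of M] show False by simp
  qed
  have e2_le: "e2 \<le> d * (d - 1)"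
    unfolding e2_def d_def using deg_le_card_minus_one[OF finN irr]
    by (metis (no_types, lifting) of_nat_id sum_bounded_above)
  have d_pos: "1 \<le> d" using D0 by (simp add: D_def)
  have e2_le': "real e2 \<le> D * (D - 1)"
  proof -
    have "real e2 \<le> real (d * (d - 1))" using e2_le by (rule of_nat_mono)
    then show ?thesis using d_pos by (simp add: D_def of_nat_diff)
  qed
  \<comment> \<open>Comparing with the trivial bound on \<open>e2\<close> gives \<open>D\<close> at
    least \<open>2 * K - 1 - s\<close>; as \<open>s < 1\<close>, integrality rounds this up to
    \<open>2 * k - 1\<close>.\<close>
  have "D * (2 * K - 2 - s) \<le> D * (D - 1)" using ineq' e2_le' by linarith
  then have "2 * K - 2 - s \<le> D - 1" using D0 by simp
  then have "real (2 * k) < real (d + 2)" using s by (simp add: K_def D_def)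
  then have d_ge: "2 * k \<le> d + 1" by linarith
  \<comment> \<open>The average degree inside \<open>N\<close> is at least
    \<open>2 * K - 2 - s\<close>, which exceeds \<open>K - 1\<close>.\<close>
  have "\<exists>u\<in>N. k \<le> deg E N u"
  proof (rule ccontr)
    assume "\<not> ?thesis"
    then have "deg E N u \<le> k - 1" if "u \<in> N" for u using that by fastforce
    then have "e2 \<le> d * (k - 1)"
      unfolding e2_def d_def by (metis (no_types, lifting) of_nat_id sum_bounded_above)
    then have "real e2 \<le> real (d * (k - 1))" by (rule of_nat_mono)
    then have "D * (2 * K - 2 - s) \<le> D * (K - 1)"
      using ineq' k2 by (simp add: K_def D_def of_nat_diff)
    then have "2 * K - 2 - s \<le> K - 1" using D0 by simp
    then show False using K2 s by simp
  qed
  then obtain u where u: "u \<in> N" "k \<le> deg E N u" by blast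
  \<comment> \<open>If \<open>C\<close> had \<open>k\<close> vertices, then \<open>C\<close> and the
    neighbours of \<open>u\<close> in \<open>N\<close> would be completely joined inside the
    neighbourhood of \<open>u\<close>, giving a fan. So all but at most \<open>k - 1\<close>
    vertices of \<open>W\<close> miss a vertex of \<open>N\<close>, which bounds \<open>eb\<close>
    from below.\<close>
  define C where "C = {w \<in> W. \<forall>a\<in>N. (a, w) \<in> E}"
  have "card C < k"
  proof (rule ccontr)
    assume "\<not> ?thesis"
    then show False
      using u NV by (intro fan[of u "nbhd E N u" C]) (auto simp: C_def W_def nbhd_def)
  qed
  moreover have "card W \<le> card C + eb"
    unfolding C_def eb_def by (rule card_le_common_nbhd[OF finN finW])
  ultimately have "card W + 1 \<le> k + eb" by linarith
  then have eb_ge: "real (card V) - D - K \<le> real eb"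
    using cW by (simp add: K_def)
  \<comment> \<open>The lower bound on the order enters here, through \<open>eb_ge\<close>.\<close>
  have e2_ge: "D * (2 * K - 3 - s) + 3 * K\<^sup>2 - 2 * K - 2 \<le> real e2"
    using ineq' eb_ge n by (simp add: K_def algebra_simps)
  \<comment> \<open>Only \<open>d = 2 * k - 1\<close> is left to exclude; there the trivial bound on
    \<open>e2\<close> contradicts \<open>e2_ge\<close>.\<close>
  have d_ge': "2 * k \<le> d"
  proof (rule ccontr)
    assume "\<not> ?thesis"
    then have "d + 1 = 2 * k" using d_ge by simp
    then have D: "D = 2 * K - 1" unfolding D_def K_def by linarith
    have "D * (2 * K - 3 - s) + 3 * K\<^sup>2 - 2 * K - 2 \<le> D * (2 * K - 2)"
      using e2_ge e2_le' by (simp add: D)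
    then have "3 * K\<^sup>2 - 2 * K - 2 \<le> D * (1 + s)" by (simp add: algebra_simps)
    also have "\<dots> < D * 2" using s D0 by simp
    finally have "3 * K * (K - 2) < 0" by (simp add: D algebra_simps power2_eq_square)
    then show False using K2 by (simp add: mult_less_0_iff)
  qed
  have "\<exists>T\<subseteq>N. card T = k - 1 \<and> (\<forall>a\<in>N - T. \<forall>b\<in>N - T. (a, b) \<notin> E)"
  proof (rule dense_matching_bounded_cover[OF finN symE irr])
    show "card M < k" if "matching E N M" for M
      using nofan[OF vV, of M] that by (simp add: N_def)
    show "2 * k \<le> card N" using d_ge' by (simp add: d_def)
    \<comment> \<open>This expression is the lower bound in \<open>e2_ge\<close> minus the density
      threshold of the covering lemma.\<close>
    have "0 < D * (1 - s) + (3 * K + 2) * (K - 2)"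
      using D0 s K2 by (intro add_pos_nonneg mult_pos_pos mult_nonneg_nonneg) auto
    then have "2 * (K - 1) * (D - 1) - 2 * (D - 2 * K) < real e2"
      using e2_ge by (simp add: algebra_simps power2_eq_square)
    then have "real_of_int (2 * (int k - 1) * (int d - 1) - 2 * (int d - 2 * int k))
        < real_of_int (int e2)"
      by (simp add: K_def D_def)
    then show "2 * (int k - 1) * (int (card N) - 1) - 2 * (int (card N) - 2 * int k)
        < int (\<Sum>u\<in>N. deg E N u)"
      unfolding of_int_less_iff by (simp add: d_def e2_def)
  qed
  then obtain T where T: "T \<subseteq> N" "card T = k - 1" "\<And>a b. a \<in> N - T \<Longrightarrow> b \<in> N - T \<Longrightarrow> (a, b) \<notin> E"
    by blast
  define I where "I = N - T"
  have finT: "finite T" and finI: "finite I" using T(1) finN finite_subset by (auto simp: I_def)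
  have cT: "real (card T) = K - 1" using T(2) k2 by (simp add: K_def of_nat_diff)
  have cI: "real (card I) = D - K + 1"
  proof -
    have "card I = d - (k - 1)" using T finT by (simp add: I_def card_Diff_subset d_def)
    then show ?thesis using d_ge' k2 by (simp add: K_def D_def of_nat_diff)
  qed
  have BI: "V - I = insert v (T \<union> W)" using vV vN NV T(1) by (auto simp: I_def W_def)
  \<comment> \<open>\<open>f\<close> counts the non-adjacent pairs between \<open>T\<close> and
    \<open>I\<close>. The vertices of \<open>I0\<close> are joined to all of \<open>V - I\<close>,
    since \<open>v\<close> is adjacent to all of \<open>N\<close> anyway.\<close>
  define f where "f = (\<Sum>u\<in>T. deg (- E) I u)"
  define I0 where "I0 = {i \<in> I. \<forall>b\<in>T \<union> W. (b, i) \<in> E}"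
  have TI: "N = T \<union> I" "T \<inter> I = {}" using T(1) by (auto simp: I_def)
  have eb_I: "(\<Sum>w\<in>W. deg (- E) I w) \<le> eb"
  proof -
    have "(\<Sum>w\<in>W. deg (- E) I w) = (\<Sum>i\<in>I. deg (- E) W i)"
      by (rule sum_deg_swap[OF finW finI symEc])
    also have "\<dots> \<le> eb" unfolding eb_def using finN by (intro sum_mono2) (auto simp: I_def)
    finally show ?thesis .
  qed
  have "card I \<le> card I0 + (\<Sum>b\<in>T \<union> W. deg (- E) I b)"
    unfolding I0_def using finT finW finI by (intro card_le_common_nbhd) auto
  also have "(\<Sum>b\<in>T \<union> W. deg (- E) I b) = f + (\<Sum>w\<in>W. deg (- E) I w)"
    unfolding f_def using finT finW T(1) by (intro sum.union_disjoint) (auto simp: W_def)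
  finally have I0: "card I \<le> card I0 + f + eb" using eb_I by linarith
  \<comment> \<open>\<open>T\<close> spans at most \<open>(K - 1) * (K - 2)\<close> arcs,
    \<open>I\<close> spans none, and each of the remaining edges between \<open>T\<close> and
    \<open>I\<close> counts twice.\<close>
  have e2_eq: "real e2 \<le> (K - 1) * (K - 2) + 2 * ((K - 1) * (D - K + 1) - real f)"
  proof -
    have dN: "deg E N u = deg E T u + deg E I u" for u
      unfolding TI(1) by (rule deg_Un_disjoint[OF finT finI TI(2)])
    have dI: "deg E I u = 0" if "u \<in> I" for u
    proof -
      have "nbhd E I u = {}" using T(3) that by (auto simp: nbhd_def I_def)
      then show ?thesis by simp
    qed
    have "e2 = (\<Sum>u\<in>T. deg E N u) + (\<Sum>u\<in>I. deg E N u)"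
      using sum.union_disjoint[OF finT finI TI(2), of "deg E N"]
      unfolding TI(1)[symmetric] e2_def .
    also have "\<dots> = (\<Sum>u\<in>T. deg E T u) + (\<Sum>u\<in>T. deg E I u) + (\<Sum>u\<in>I. deg E T u)"
      by (simp add: dN dI sum.distrib)
    also have "(\<Sum>u\<in>I. deg E T u) = (\<Sum>u\<in>T. deg E I u)"
      by (rule sum_deg_swap[OF finI finT symE])
    also have "(\<Sum>u\<in>T. deg E T u) \<le> card T * (card T - 1)"
      using deg_le_card_minus_one[OF finT irr] by (metis (no_types, lifting) of_nat_id sum_bounded_above)
    finally have "e2 \<le> card T * (card T - 1) + (\<Sum>u\<in>T. deg E I u) + (\<Sum>u\<in>T. deg E I u)"
      by simp
    then have "real e2
        \<le> real (card T * (card T - 1) + (\<Sum>u\<in>T. deg E I u) + (\<Sum>u\<in>T. deg E I u))"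
      by (rule of_nat_mono)
    then have "real e2 \<le> real (card T * (card T - 1)) + 2 * real (\<Sum>u\<in>T. deg E I u)"
      by (simp only: of_nat_add mult_2 add.assoc)
    moreover have "real (card T * (card T - 1)) = (K - 1) * (K - 2)"
      using k2 by (simp add: T(2) K_def of_nat_diff)
    moreover have "real (\<Sum>u\<in>T. deg E I u) = (K - 1) * (D - K + 1) - real f"
    proof -
      have "(\<Sum>u\<in>T. deg E I u) + f = card T * card I"
        unfolding f_def sum.distrib[symmetric] by (simp add: deg_add_deg_Compl[OF finI])
      then have "real ((\<Sum>u\<in>T. deg E I u) + f) = real (card T * card I)"
        by (rule arg_cong)
      then have "real (\<Sum>u\<in>T. deg E I u) + real f = real (card T) * real (card I)"
        by (simp only: of_nat_add of_nat_mult)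
      then show ?thesis by (simp add: cT cI)
    qed
    ultimately show ?thesis by simp
  qed
  \<comment> \<open>The upper bound on \<open>e2\<close> turns Merris' inequality into a bound on
    all missing pairs, so few vertices of \<open>I\<close> fall outside \<open>I0\<close>.\<close>
  have "2 * real f + real eb \<le> s * D - K * (K - 1)"
    using ineq' e2_eq by (simp add: algebra_simps)
  moreover have "D - K + 1 \<le> real (card I0) + real f + real eb"
    using I0 cI by linarith
  ultimately have "D * (1 - s) + (K - 1)\<^sup>2 \<le> real (card I0)"
    by (simp add: algebra_simps power2_eq_square)
  moreover have "0 < D * (1 - s)" using D0 s by simp
  moreover have "K - 1 \<le> (K - 1)\<^sup>2" using K2 by (simp add: power2_eq_square)
  ultimately have "K - 1 < real (card I0)" by linarith
  then have cI0: "k \<le> card I0" unfolding K_def by linarith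
  have full: "(b, i) \<in> E" if "b \<in> V - I" "i \<in> I0" for b i
    using that unfolding BI by (auto simp: I0_def I_def N_def nbhd_def)
  show ?thesis
  proof (intro exI conjI ballI)
    show "I \<subseteq> V" using NV by (auto simp: I_def)
    show "(i, j) \<notin> E" if "i \<in> I" "j \<in> I" for i j using T(3) that by (simp add: I_def)
    have "card (insert v T) = k" using T vN finT k2 by (subst card_insert_disjoint) auto
    moreover have "card (insert v T) \<le> card (V - I)"
      using finT finW by (intro card_mono) (auto simp: BI)
    ultimately show "k \<le> card (V - I)" by simp
    fix u assume u: "u \<in> V - I"
    show "deg E (V - I) u < k"
    \<comment> \<open>Otherwise \<open>k\<close> neighbours of \<open>u\<close> in
      \<open>V - I\<close> and \<open>k\<close> vertices of \<open>I0\<close> would be completely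
      joined inside the neighbourhood of \<open>u\<close>.\<close>
    proof (rule ccontr)
      assume "\<not> ?thesis"
      then have *: "k \<le> deg E (V - I) u" by simp
      show False
      proof (rule fan[OF _ _ _ _ _ * cI0])
        show "I0 \<subseteq> nbhd E V u" using full[OF u] NV by (auto simp: nbhd_def I0_def I_def)
        show "nbhd E (V - I) u \<times> I0 \<subseteq> E" using full by (auto simp: nbhd_def)
      qed (use u in \<open>auto simp: nbhd_def I0_def\<close>)
    qed
  qed
qed

section \<open>Subeigenvectors\<close>

text \<open>
  Merris' bound, for the vertex that maximises \<open>y u / deg u\<close>. Working with a nonnegative
  subeigenvector, such as the absolute value of an eigenvector, avoids Perron--Frobenius theory.
\<close>

lemma weighted_degree_bound:
  fixes y :: "'a \<Rightarrow> real" and lam :: real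
  assumes fin: "finite V" and symE: "sym E"
    and nonneg: "\<And>u. u \<in> V \<Longrightarrow> 0 \<le> y u" and pos: "\<exists>u\<in>V. 0 < y u" and lam: "0 < lam"
    and sub: "\<And>u. u \<in> V \<Longrightarrow> lam * y u \<le> real (deg E V u) * y u + (\<Sum>w\<in>nbhd E V u. y w)"
  shows "\<exists>v\<in>V. 0 < deg E V v \<and>
    lam * real (deg E V v) \<le> (real (deg E V v))\<^sup>2 + real (\<Sum>u\<in>nbhd E V v. deg E V u)"
proof -
  \<comment> \<open>Restricting to positive degree keeps the quotient \<open>y u / deg E V u\<close>
    away from division by zero. By \<open>deg0\<close> no vertex of positive weight is lost.\<close>
  define S where "S = {u \<in> V. 0 < deg E V u}"
  have deg0: "0 < deg E V u" if "u \<in> V" "0 < y u" for u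
  proof (rule ccontr)
    assume "\<not> ?thesis"
    then have "nbhd E V u = {}" using fin by simp
    then have "lam * y u \<le> 0" using sub[OF that(1)] by simp
    then show False using lam that(2) by (simp add: mult_le_0_iff)
  qed
  obtain u0 where u0: "u0 \<in> V" "0 < y u0" using pos by blast
  have finS: "finite S" using fin by (simp add: S_def)
  have u0S: "u0 \<in> S" using u0 deg0 by (simp add: S_def)
  obtain v where v: "v \<in> S" "\<And>u. u \<in> S \<Longrightarrow> y u / deg E V u \<le> y v / deg E V v"
  proof -
    let ?r = "\<lambda>u. y u / deg E V u"
    have "Max (?r ` S) \<in> ?r ` S" using finS u0S by (intro Max_in) auto
    then obtain v where "v \<in> S" "Max (?r ` S) = ?r v" by blast
    then show ?thesis using that[of v] Max_ge[of "?r ` S"] finS by auto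
  qed
  define r where "r = y v / deg E V v"
  let ?d = "real (deg E V v)"
  have vV: "v \<in> V" and d: "0 < ?d" using v(1) by (auto simp: S_def)
  have r: "0 < r"
    using v(2)[OF u0S] u0 deg0[OF u0] unfolding r_def
    by (smt (verit) divide_pos_pos of_nat_0_less_iff)
  have yv: "y v = r * ?d" using d by (simp add: r_def)
  have yu: "y u \<le> r * real (deg E V u)" if "u \<in> nbhd E V v" for u
  proof -
    have "v \<in> nbhd E V u" "u \<in> V"
      using that symD[OF symE, of v u] vV by (auto simp: nbhd_def)
    then have "0 < deg E V u" using fin by (auto simp: card_gt_0_iff)
    then show ?thesis
      using v(2)[of u] \<open>u \<in> V\<close> by (simp add: S_def r_def pos_divide_le_eq)
  qed
  have "lam * y v \<le> ?d * y v + (\<Sum>w\<in>nbhd E V v. y w)" by (rule sub[OF vV])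
  also have "(\<Sum>w\<in>nbhd E V v. y w) \<le> (\<Sum>w\<in>nbhd E V v. r * real (deg E V w))"
    by (rule sum_mono[OF yu])
  also have "\<dots> = r * real (\<Sum>w\<in>nbhd E V v. deg E V w)"
    by (simp add: sum_distrib_left)
  finally have "r * (lam * ?d) \<le> r * (?d\<^sup>2 + real (\<Sum>w\<in>nbhd E V v. deg E V w))"
    by (simp add: yv algebra_simps power2_eq_square)
  then have "lam * ?d \<le> ?d\<^sup>2 + real (\<Sum>w\<in>nbhd E V v. deg E V w)" using r by simp
  then show ?thesis using vV d by auto
qed

text \<open>This puts Merris' bound into the form \<open>ineq\<close> of the structure lemma. A
  vertex of \<open>N\<close> is adjacent to \<open>v\<close>, to some of \<open>N\<close>, and to
  all of the remaining vertices except its non-neighbours; summing over \<open>N\<close> collects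
  the main terms into \<open>card N * card V\<close>.\<close>

lemma sum_deg_nbhd_eq:
  assumes fin: "finite V" and symE: "sym E" and irr: "irrefl E" and vV: "v \<in> V"
  defines "N \<equiv> nbhd E V v"
  shows "(real (card N))\<^sup>2 + real (\<Sum>u\<in>N. deg E V u)
    = real (card N) * real (card V) + real (\<Sum>u\<in>N. deg E N u)
      - real (\<Sum>u\<in>N. deg (- E) (V - N - {v}) u)"
proof -
  define W where "W = V - N - {v}"
  have NV: "N \<subseteq> V" by (simp add: N_def nbhd_subset)
  have vN: "v \<notin> N" using irr by (auto simp: N_def nbhd_def irrefl_def)
  have finN: "finite N" and finW: "finite W" using NV fin finite_subset by (auto simp: W_def)
  have V: "V = {v} \<union> (N \<union> W)" using vV NV by (auto simp: W_def)
  have cV: "card V = 1 + (card N + card W)"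
  proof -
    have "card V = card ({v} \<union> (N \<union> W))" using V by (rule arg_cong)
    also have "\<dots> = 1 + card (N \<union> W)" using finN finW vN by (simp add: W_def)
    also have "card (N \<union> W) = card N + card W"
      using finN finW by (intro card_Un_disjoint) (auto simp: W_def)
    finally show ?thesis .
  qed
  have dV: "deg E V u + deg (- E) W u = 1 + deg E N u + card W" if "u \<in> N" for u
  proof -
    have "deg E V u = deg E {v} u + deg E (N \<union> W) u"
      using vN finN finW by (subst V, intro deg_Un_disjoint) (auto simp: W_def)
    also have "deg E (N \<union> W) u = deg E N u + deg E W u"
      using finN finW by (intro deg_Un_disjoint) (auto simp: W_def)
    also have "nbhd E {v} u = {v}"
      using that symD[OF symE, of v u] by (auto simp: N_def nbhd_def)
    finally have "deg E V u = 1 + deg E N u + deg E W u" by simp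
    then show ?thesis using deg_add_deg_Compl[OF finW, of E u] by simp
  qed
  have "(\<Sum>u\<in>N. deg E V u) + (\<Sum>u\<in>N. deg (- E) W u) = (\<Sum>u\<in>N. 1 + deg E N u + card W)"
    unfolding sum.distrib[symmetric] by (rule sum.cong[OF refl dV])
  also have "\<dots> = card N + (\<Sum>u\<in>N. deg E N u) + card N * card W"
    by (simp only: sum.distrib) simp
  finally have "real ((\<Sum>u\<in>N. deg E V u) + (\<Sum>u\<in>N. deg (- E) W u))
      = real (card N + (\<Sum>u\<in>N. deg E N u) + card N * card W)"
    by (rule arg_cong)
  then have "real (\<Sum>u\<in>N. deg E V u) + real (\<Sum>u\<in>N. deg (- E) W u)
      = real (card N) + real (\<Sum>u\<in>N. deg E N u) + real (card N) * real (card W)"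
    by (simp only: of_nat_add of_nat_mult)
  then show ?thesis
    unfolding W_def[symmetric] cV by (simp add: algebra_simps power2_eq_square)
qed

text \<open>
  Comparing the inequality at a maximal entry on \<open>V - I\<close> with those on \<open>I\<close> gives
  \<open>lam\<^sup>2 - (card V + 2 * k - 2) * lam + 2 * (k - 1) * card (V - I) \<le> 0\<close>, with equality only if
  all the degree estimates used are tight.
\<close>

lemma subeigenvector_forces_complete_split:
  fixes y :: "'a \<Rightarrow> real" and lam :: real and k :: nat
  assumes fin: "finite V" and symE: "sym E" and irr: "irrefl E"
    and k2: "2 \<le> k" and kn: "k < card V"
    and IV: "I \<subseteq> V" and indep: "\<And>i j. i \<in> I \<Longrightarrow> j \<in> I \<Longrightarrow> (i, j) \<notin> E"
    and cB: "k \<le> card (V - I)" and degB: "\<And>u. u \<in> V - I \<Longrightarrow> deg E (V - I) u < k"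
    and nonneg: "\<And>u. u \<in> V \<Longrightarrow> 0 \<le> y u" and pos: "\<exists>u\<in>V. 0 < y u"
    and sub: "\<And>u. u \<in> V \<Longrightarrow> lam * y u \<le> real (deg E V u) * y u + (\<Sum>w\<in>nbhd E V u. y w)"
    and lam: "real (card V) < lam"
    and poly: "0 \<le> lam\<^sup>2 - (real (card V) + 2 * real k - 2) * lam + 2 * real k * (real k - 1)"
  shows "card (V - I) = k" "\<And>a b. a \<in> V - I \<Longrightarrow> b \<in> V - I \<Longrightarrow> a \<noteq> b \<Longrightarrow> (a, b) \<in> E"
    "\<And>a i. a \<in> V - I \<Longrightarrow> i \<in> I \<Longrightarrow> (a, i) \<in> E"
proof -
  define B where "B = V - I"
  define m be K where "m = real (card I)" and "be = real (card B)" and "K = real k"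
  have finB: "finite B" and finI: "finite I" using fin IV finite_subset by (auto simp: B_def)
  have VBI: "V = B \<union> I" "B \<inter> I = {}" using IV by (auto simp: B_def)
  have "card V = card B + card I"
    using card_Un_disjoint[OF finB finI VBI(2)] VBI(1) by simp
  then have n: "real (card V) = m + be" by (simp add: m_def be_def)
  have K2: "2 \<le> K" and m0: "0 \<le> m" and beK: "K \<le> be"
    using k2 cB by (auto simp: K_def m_def be_def B_def)
  have lb: "0 < lam - be" using lam n m0 by simp
  have ne: "B \<noteq> {}"
  proof
    assume "B = {}"
    then show False using cB k2 by (simp flip: B_def)
  qed
  obtain b where b: "b \<in> B" "\<And>u. u \<in> B \<Longrightarrow> y u \<le> y b"
  proof -
    have "Max (y ` B) \<in> y ` B" using finB ne by (intro Max_in) auto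
    then obtain b where "b \<in> B" "Max (y ` B) = y b" by blast
    then show ?thesis using that[of b] Max_ge[of "y ` B"] finB by auto
  qed
  define Y where "Y = y b"
  have degV: "deg E V u = deg E B u + deg E I u" for u
    unfolding VBI(1) by (rule deg_Un_disjoint[OF finB finI VBI(2)])
  have sumV: "(\<Sum>w\<in>nbhd E V u. y w) = (\<Sum>w\<in>nbhd E B u. y w) + (\<Sum>w\<in>nbhd E I u. y w)" for u
    unfolding VBI(1) nbhd_Un using finB finI VBI(2)
    by (intro sum.union_disjoint) (auto simp: nbhd_def)
  have sumB: "(\<Sum>w\<in>nbhd E B u. y w) \<le> real (deg E B u) * Y" for u
    using b(2) by (intro sum_bounded_above) (auto simp: nbhd_def Y_def)
  have Y0: "0 \<le> Y" using nonneg b(1) by (simp add: Y_def B_def)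
  have onI: "(lam - real (deg E B i)) * y i \<le> (\<Sum>w\<in>nbhd E B i. y w)" if "i \<in> I" for i
  proof -
    have "nbhd E I i = {}" using indep that by (auto simp: nbhd_def)
    then show ?thesis using sub[of i] degV[of i] sumV[of i] that IV by (auto simp: algebra_simps)
  qed
  have dB: "real (deg E B u) \<le> be" for u
    using deg_le_card[OF finB, of E u] by (simp add: be_def)
  have yI: "(lam - be) * y i \<le> be * Y" if "i \<in> I" for i
  proof -
    have "(lam - be) * y i \<le> (lam - real (deg E B i)) * y i"
      using dB[of i] nonneg that IV by (intro mult_right_mono) auto
    also have "\<dots> \<le> real (deg E B i) * Y" using onI[OF that] sumB[of i] by linarith
    also have "\<dots> \<le> be * Y" using dB[of i] Y0 by (rule mult_right_mono)
    finally show ?thesis .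
  qed
  have Ypos: "0 < Y"
  proof (rule ccontr)
    assume "\<not> 0 < Y"
    then have Yz: "Y = 0" using Y0 by simp
    obtain u where u: "u \<in> V" "0 < y u" using pos by blast
    show False
    proof (cases "u \<in> B")
      case True
      then show ?thesis using b(2)[of u] u Yz by (simp add: Y_def)
    next
      case False
      then have "(lam - be) * y u \<le> 0" using yI[of u] u Yz by (simp add: B_def)
      moreover have "0 < (lam - be) * y u" using lb u(2) by simp
      ultimately show ?thesis by linarith
    qed
  qed
  \<comment> \<open>By \<open>yI\<close>, \<open>c\<close> bounds \<open>y\<close> on
    \<open>I\<close>; in the extremal case it is attained everywhere on \<open>I\<close>.\<close>
  define c where "c = be * Y / (lam - be)"
  have c: "(lam - be) * c = be * Y" using lb by (simp add: c_def)
  have be0: "0 < be" using beK K2 by linarith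
  have c0: "0 < c" using lb Ypos be0 by (simp add: c_def)
  have yc: "y i \<le> c" if "i \<in> I" for i
    using yI[OF that] lb by (simp add: c_def pos_le_divide_eq mult.commute)
  have dBk: "real (deg E B u) \<le> K - 1" if "u \<in> B" for u
    using degB[of u] that unfolding K_def B_def by fastforce
  have dI: "real (deg E I u) \<le> m" for u
    using deg_le_card[OF finI, of E u] by (simp add: m_def)
  have sumI: "(\<Sum>w\<in>nbhd E I u. y w) \<le> real (deg E I u) * c" for u
    using yc by (intro sum_bounded_above) (auto simp: nbhd_def)
  have onB: "lam * Y \<le> (2 * real (deg E B u) + real (deg E I u)) * Y + (\<Sum>w\<in>nbhd E I u. y w)"
    if "u \<in> B" "y u = Y" for u
    using sub[of u] that degV[of u] sumV[of u] sumB[of u] by (simp add: B_def algebra_simps)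
  have "lam * Y \<le> (2 * real (deg E B b) + real (deg E I b)) * Y + real (deg E I b) * c"
    using onB[of b] b(1) sumI[of b] by (simp add: Y_def)
  also have "\<dots> \<le> (2 * (K - 1) + m) * Y + m * c"
    using dBk[OF b(1)] dI[of b] Y0 c0 by (intro add_mono mult_right_mono) auto
  finally have top: "lam * Y \<le> (2 * (K - 1) + m) * Y + m * c" .
  \<comment> \<open>Multiplying by \<open>lam - be\<close> eliminates \<open>c\<close>, so that
    \<open>Y\<close> can be cancelled and an inequality in \<open>lam\<close> alone remains.\<close>
  have "(lam * Y) * (lam - be) \<le> ((2 * (K - 1) + m) * Y + m * c) * (lam - be)"
    using top lb by (intro mult_right_mono) auto
  also have "\<dots> = (2 * (K - 1) + m) * (lam - be) * Y + m * ((lam - be) * c)"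
    by (simp add: algebra_simps)
  also have "\<dots> = ((2 * (K - 1) + m) * (lam - be) + m * be) * Y"
    unfolding c by (simp add: algebra_simps)
  finally have "(lam * (lam - be)) * Y \<le> ((2 * (K - 1) + m) * (lam - be) + m * be) * Y"
    by (simp add: algebra_simps)
  then have le: "lam * (lam - be) \<le> (2 * (K - 1) + m) * (lam - be) + m * be"
    using Ypos by simp
  have poly': "0 \<le> lam\<^sup>2 - (m + be + 2 * K - 2) * lam + 2 * K * (K - 1)"
    using poly by (simp add: n K_def)
  \<comment> \<open>In \<open>le\<close> and \<open>poly'\<close> the quadratic and linear terms in
    \<open>lam\<close> agree, so only the constant terms are compared.\<close>
  have "2 * (K - 1) * be \<le> 2 * (K - 1) * K"
    using le poly' by (simp add: algebra_simps power2_eq_square)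
  then have "be \<le> K" using K2 by simp
  then have be: "be = K" using beK by simp
  then show cBk: "card (V - I) = k" by (simp add: be_def K_def B_def)
  \<comment> \<open>Once \<open>be = K\<close>, \<open>le\<close> and \<open>poly'\<close> bound the
    same polynomial from both sides, so the whole chain is an equality.\<close>
  have eq: "lam * Y = (2 * (K - 1) + m) * Y + m * c"
  proof -
    have "lam * (lam - K) = (2 * (K - 1) + m) * (lam - K) + m * K"
      using le poly' by (simp add: be algebra_simps power2_eq_square)
    then have "(lam * (lam - K)) * Y = ((2 * (K - 1) + m) * (lam - K) + m * K) * Y" by simp
    also have "\<dots> = (2 * (K - 1) + m) * (lam - K) * Y + m * (be * Y)"
      by (simp add: be algebra_simps)
    also have "\<dots> = ((2 * (K - 1) + m) * Y + m * c) * (lam - K)"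
      unfolding c[symmetric] by (simp add: be algebra_simps)
    finally have "(lam * Y) * (lam - K) = ((2 * (K - 1) + m) * Y + m * c) * (lam - K)"
      by (simp add: algebra_simps)
    then show ?thesis using lb be by simp
  qed
  \<comment> \<open>This is stated for every \<open>u\<close> attaining \<open>Y\<close>, not only
    for \<open>b\<close>, because \<open>yB\<close> later shows that all of \<open>B\<close> attains
    it. The slack is a sum of nonnegative terms and so each term vanishes.\<close>
  have tight: "deg E B u = k - 1 \<and> deg E I u = card I \<and> (\<Sum>w\<in>nbhd E I u. y w) = m * c"
    if "u \<in> B" "y u = Y" for u
  proof -
    define p q where "p = real (deg E B u)" and "q = real (deg E I u)"
    have pq: "p \<le> K - 1" "q \<le> m" using dBk[OF that(1)] dI[of u] by (auto simp: p_def q_def)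
    have a1: "(2 * (K - 1) + m) * Y + m * c \<le> (2 * p + q) * Y + (\<Sum>w\<in>nbhd E I u. y w)"
      using onB[OF that] eq by (simp add: p_def q_def)
    have a2: "(\<Sum>w\<in>nbhd E I u. y w) \<le> q * c" using sumI[of u] by (simp add: q_def)
    have "2 * (K - 1 - p) * Y + (m - q) * (Y + c) \<le> 0"
      using a1 a2 by (simp add: algebra_simps)
    moreover have "0 \<le> 2 * (K - 1 - p) * Y" "0 \<le> (m - q) * (Y + c)"
      using pq Ypos c0 by (auto intro!: mult_nonneg_nonneg)
    ultimately have "2 * (K - 1 - p) * Y = 0" "(m - q) * (Y + c) = 0" by linarith+
    then have p: "p = K - 1" and q: "q = m" using Ypos c0 by auto
    moreover have "(\<Sum>w\<in>nbhd E I u. y w) = m * c"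
      using a1 a2 p q by (simp add: algebra_simps)
    moreover have "deg E B u = k - 1" using p k2 unfolding p_def K_def by linarith
    ultimately show ?thesis by (simp add: q_def m_def)
  qed
  have full_I: "nbhd E I u = I" if "u \<in> B" "y u = Y" for u
    using tight[OF that] finI by (intro card_subset_eq nbhd_subset) auto
  have yI_eq: "y i = c" if "i \<in> I" for i
  proof (rule ccontr)
    assume "y i \<noteq> c"
    then have "y i < c" using yc[OF that] by simp
    then have "(\<Sum>w\<in>I. y w) < (\<Sum>w\<in>I. c)"
      using yc that finI by (intro sum_strict_mono_ex1) auto
    moreover have "(\<Sum>w\<in>I. y w) = m * c"
      using tight[of b] full_I[of b] b(1) by (simp add: Y_def)
    ultimately show False by (simp add: m_def)
  qed
  have "I \<noteq> {}"
    using kn cBk fin by (metis Diff_empty less_irrefl)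
  then obtain i where i: "i \<in> I" by blast
  \<comment> \<open>With \<open>y i = c\<close>, fewer than \<open>card B\<close> neighbours in
    \<open>B\<close> would contradict the equation \<open>c\<close> that defines this value.\<close>
  have adj_i: "nbhd E B i = B" if "i \<in> I" for i
  proof -
    define de where "de = real (deg E B i)"
    have "(lam - de) * c \<le> de * Y"
      using onI[OF that] sumB[of i] yI_eq[OF that] by (simp add: de_def)
    then have "((lam - de) * c) * (lam - be) \<le> de * Y * (lam - be)"
      using lb by (intro mult_right_mono) auto
    moreover have "((lam - de) * c) * (lam - be) = (lam - de) * (be * Y)"
      unfolding c[symmetric] by (simp add: mult_ac)
    ultimately have "(be * lam) * Y \<le> (de * lam) * Y" by (simp add: algebra_simps)
    then have "be * lam \<le> de * lam" using Ypos by (rule mult_right_le_imp_le)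
    moreover have "0 < lam" using lb be0 by simp
    ultimately have "be \<le> de" by simp
    then have "card (nbhd E B i) = card B"
      using deg_le_card[OF finB, of E i] by (simp add: be_def de_def)
    then show ?thesis using finB by (intro card_subset_eq nbhd_subset) auto
  qed
  \<comment> \<open>The inequality at one vertex \<open>i\<close> of \<open>I\<close> forces the sum
    of \<open>y\<close> over \<open>B\<close> to reach \<open>be * Y\<close>.\<close>
  have yB: "y u = Y" if "u \<in> B" for u
  proof (rule ccontr)
    assume "y u \<noteq> Y"
    then have "y u < Y" using b(2)[OF that] by (simp add: Y_def)
    then have "(\<Sum>w\<in>B. y w) < (\<Sum>w\<in>B. Y)"
      using b(2) that finB by (intro sum_strict_mono_ex1) (auto simp: Y_def)
    moreover have "be * Y \<le> (\<Sum>w\<in>B. y w)"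
      using onI[OF i] yI_eq[OF i] adj_i[OF i] c by (simp add: be_def)
    ultimately show False by (simp add: be_def)
  qed
  show "(a, i) \<in> E" if "a \<in> V - I" "i \<in> I" for a i
  proof -
    have "i \<in> nbhd E I a" using full_I[of a] yB[of a] that by (simp add: B_def)
    then show ?thesis by (simp add: nbhd_def)
  qed
  show "(a, a') \<in> E" if aB: "a \<in> V - I" "a' \<in> V - I" "a \<noteq> a'" for a a'
  proof -
    have a: "a \<in> B" using aB by (simp add: B_def)
    have "nbhd E B a = B - {a}"
    proof (rule card_subset_eq)
      show "nbhd E B a \<subseteq> B - {a}" using irr by (auto simp: nbhd_def irrefl_def)
      show "deg E B a = card (B - {a})"
        using tight[OF a yB[OF a]] a cBk finB by (simp add: B_def)
    qed (use finB in auto)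
    then have "a' \<in> nbhd E B a" using aB by (simp add: B_def)
    then show ?thesis by (simp add: nbhd_def)
  qed
qed

section \<open>Isomorphisms and fans\<close>

lemma wf_digraph_with_proj: "pair_graph G \<Longrightarrow> wf_digraph (with_proj G)"
  using pair_graphD(2)[of G] by unfold_locales auto

text \<open>Tails and heads are \<open>fst\<close> and \<open>snd\<close> on both sides, so the arc
  map of an isomorphism is determined by its vertex map.\<close>

lemma digraph_iso_with_proj_iff:
  assumes G: "pair_graph G" and H: "pair_graph H"
  shows "digraph_iso (with_proj G) (with_proj H) \<longleftrightarrow>
    (\<exists>h. bij_betw h (pverts G) (pverts H) \<and>
      (\<forall>u\<in>pverts G. \<forall>v\<in>pverts G. (u, v) \<in> parcs G \<longleftrightarrow> (h u, h v) \<in> parcs H))"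
    (is "_ \<longleftrightarrow> ?R")
proof
  assume "digraph_iso (with_proj G) (with_proj H)"
  then obtain f where f: "pre_digraph.digraph_isomorphism (with_proj G) f"
    and eq: "with_proj H = app_iso f (with_proj G)"
    by (auto simp: digraph_iso_def)
  define h where "h = iso_verts f"
  have inj: "inj_on h (pverts G)"
    using f by (simp add: pre_digraph.digraph_isomorphism_def h_def)
  have tl: "fst = iso_tail f" and hd: "snd = iso_head f"
    using arg_cong[OF eq, of tail] arg_cong[OF eq, of head] by simp_all
  have V: "pverts H = h ` pverts G"
    using arg_cong[OF eq, of verts] by (simp add: h_def)
  have ia: "iso_arcs f a = (h (fst a), h (snd a))" if "a \<in> parcs G" for a
    using f that unfolding pre_digraph.digraph_isomorphism_def
    by (auto simp: h_def prod_eq_iff simp flip: tl hd)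
  have "parcs H = iso_arcs f ` parcs G"
    using arg_cong[OF eq, of arcs] by simp
  then have A: "parcs H = (\<lambda>a. (h (fst a), h (snd a))) ` parcs G"
    using ia by (simp cong: image_cong)
  have "(u, v) \<in> parcs G" if uv: "u \<in> pverts G" "v \<in> pverts G" and huv: "(h u, h v) \<in> parcs H"
    for u v
  proof -
    obtain a where a: "a \<in> parcs G" "h u = h (fst a)" "h v = h (snd a)" using huv A by auto
    moreover have "fst a \<in> pverts G" "snd a \<in> pverts G"
      using a(1) pair_graphD(2)[OF G] by auto
    ultimately have "u = fst a" "v = snd a" using inj uv by (auto dest: inj_onD)
    then show ?thesis using a(1) by simp
  qed
  moreover have "(h u, h v) \<in> parcs H" if "(u, v) \<in> parcs G" for u v
    unfolding A using that by (intro image_eqI[of _ _ "(u, v)"]) auto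
  ultimately show ?R
    using inj V by (intro exI[of _ h]) (auto simp: bij_betw_def)
next
  assume ?R
  then obtain h where bij: "bij_betw h (pverts G) (pverts H)"
    and iff: "\<And>u v. u \<in> pverts G \<Longrightarrow> v \<in> pverts G \<Longrightarrow> (u, v) \<in> parcs G \<longleftrightarrow> (h u, h v) \<in> parcs H"
    by blast
  have inj: "inj_on h (pverts G)" and V: "pverts H = h ` pverts G"
    using bij by (auto simp: bij_betw_def)
  have GV: "parcs G \<subseteq> pverts G \<times> pverts G" and HV: "parcs H \<subseteq> pverts H \<times> pverts H"
    using pair_graphD(2) G H by auto
  define f where "f = \<lparr>iso_verts = h, iso_arcs = map_prod h h, iso_head = snd, iso_tail = fst\<rparr>"
  have "inj_on (map_prod h h) (parcs G)"
    using map_prod_inj_on[OF inj inj] GV by (rule inj_on_subset)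
  then have "pre_digraph.digraph_isomorphism (with_proj G) f"
    using wf_digraph_with_proj[OF G] inj
    by (auto simp: pre_digraph.digraph_isomorphism_def f_def)
  moreover have "parcs H = map_prod h h ` parcs G"
  proof (intro equalityI subsetI)
    fix a assume a: "a \<in> parcs H"
    then obtain u v where "u \<in> pverts G" "v \<in> pverts G" "a = (h u, h v)" using HV V by blast
    then show "a \<in> map_prod h h ` parcs G"
      using iff a by (intro image_eqI[of _ _ "(u, v)"]) auto
  next
    fix a assume "a \<in> map_prod h h ` parcs G"
    then obtain u v where "(u, v) \<in> parcs G" "a = (h u, h v)" by auto
    then show "a \<in> parcs H" using iff GV by auto
  qed
  then have "with_proj H = app_iso f (with_proj G)"
    by (simp add: app_iso_def with_proj_def f_def V)
  ultimately show "digraph_iso (with_proj G) (with_proj H)"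
    by (auto simp: digraph_iso_def)
qed

text \<open>The copy consists of the images of the arcs of \<open>F\<close> only, so
  \<open>h\<close> has to preserve arcs but not to reflect them.\<close>

lemma not_graph_freeI:
  assumes F: "pair_graph F" and G: "pair_graph G" and inj: "inj_on h (pverts F)"
    and V: "h ` pverts F \<subseteq> pverts G"
    and A: "\<And>u v. (u, v) \<in> parcs F \<Longrightarrow> (h u, h v) \<in> parcs G"
  shows "\<not> graph_free F G"
proof -
  define H where "H = \<lparr>pverts = h ` pverts F, parcs = map_prod h h ` parcs F\<rparr>"
  have FV: "parcs F \<subseteq> pverts F \<times> pverts F" using pair_graphD(2)[OF F] .
  have HG: "parcs H \<subseteq> parcs G" using A by (auto simp: H_def)
  have "pair_graph H"
  proof (rule pair_graphI)
    show "finite (pverts H)" using pair_graphD(1)[OF F] by (simp add: H_def)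
    show "parcs H \<subseteq> pverts H \<times> pverts H" using FV by (auto simp: H_def)
    show "sym (parcs H)"
    proof (rule symI)
      fix a b assume "(a, b) \<in> parcs H"
      then obtain u v where uv: "(u, v) \<in> parcs F" "a = h u" "b = h v" by (auto simp: H_def)
      then show "(b, a) \<in> parcs H"
        using symD[OF pair_graphD(3)[OF F] uv(1)]
        by (auto simp: H_def intro!: image_eqI[of _ _ "(v, u)"])
    qed
    show "irrefl (parcs H)"
      using HG pair_graphD(4)[OF G] by (auto simp: irrefl_def)
  qed
  have "digraph_iso (with_proj F) (with_proj H)"
    unfolding digraph_iso_with_proj_iff[OF F \<open>pair_graph H\<close>]
  proof (intro exI conjI ballI)
    show "bij_betw h (pverts F) (pverts H)" using inj by (simp add: bij_betw_def H_def)
    fix u v assume uv: "u \<in> pverts F" "v \<in> pverts F"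
    show "(u, v) \<in> parcs F \<longleftrightarrow> (h u, h v) \<in> parcs H"
    proof
      assume "(h u, h v) \<in> parcs H"
      then obtain a b where ab: "(a, b) \<in> parcs F" "h u = h a" "h v = h b" by (auto simp: H_def)
      then have "u = a" "v = b" using FV inj uv by (auto dest: inj_onD)
      then show "(u, v) \<in> parcs F" using ab(1) by simp
    qed (auto simp: H_def)
  qed
  moreover have "subgraph (with_proj H) (with_proj G)"
    using V HG wf_digraph_with_proj[OF G] wf_digraph_with_proj[OF \<open>pair_graph H\<close>]
    by (simp add: subgraph_def compatible_def H_def)
  ultimately show ?thesis unfolding graph_free_def by blast
qed

text \<open>The vertex \<open>u\<close> becomes the centre of the fan and each matching edge
  completes to a triangle with it.\<close>

lemma not_fan_free_if_matching:
  assumes G: "pair_graph G" and u: "u \<in> pverts G"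
    and M: "matching (parcs G) (nbhd (parcs G) (pverts G) u) M" and k: "card M = k"
  shows "\<not> graph_free (fan_graph k) G"
proof -
  have symE: "sym (parcs G)" and irr: "irrefl (parcs G)" and fin: "finite (pverts G)"
    using pair_graphD[OF G] by auto
  have "finite M" using finite_matching[OF _ M] fin by simp
  then obtain e where e: "bij_betw e {..<k} M"
    using k by (metis ex_bij_betw_nat_finite lessThan_atLeast0)
  have eM: "e i \<in> M" if "i < k" for i using e that by (auto simp: bij_betw_def)
  have einj: "e i \<noteq> e j" if "i < k" "j < k" "i \<noteq> j" for i j
    using e that by (auto simp: bij_betw_def dest: inj_onD)
  \<comment> \<open>\<open>e i\<close> is the edge of the \<open>i\<close>-th triangle and
    \<open>j\<close> selects one of its two ends.\<close>
  define p where "p i j = (if j = (0::nat) then fst (e i) else snd (e i))" for i j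
  define h :: "nat + nat \<times> nat \<Rightarrow> _"
    where "h x = (case x of Inl _ \<Rightarrow> u | Inr (i, j) \<Rightarrow> p i j)" for x
  have eE: "(fst (e i), snd (e i)) \<in> parcs G" if "i < k" for i
    using eM[OF that] M by (auto simp: matching_def)
  have pe: "p i j \<in> {fst (e i), snd (e i)}" for i j by (simp add: p_def)
  have pN: "p i j \<in> nbhd (parcs G) (pverts G) u" if "i < k" for i j
    using eM[OF that] M pe[of i j] by (auto simp: matching_def)
  have pu: "(u, p i j) \<in> parcs G" "(p i j, u) \<in> parcs G" "p i j \<in> pverts G" if "i < k" for i j
    using pN[OF that, of j] symD[OF symE, of u "p i j"] by (auto simp: nbhd_def)
  have pne: "u \<noteq> p i j" if "i < k" for i j
    using pu(1)[OF that, of j] irr by (metis irrefl_def)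
  have pp: "(p i 0, p i (Suc 0)) \<in> parcs G" "(p i (Suc 0), p i 0) \<in> parcs G" if "i < k" for i
    using eE[OF that] symD[OF symE eE[OF that]] by (auto simp: p_def)
  have pdist: "i = i' \<and> j = j'" if "p i j = p i' j'" "i < k" "i' < k" "j < 2" "j' < 2" for i j i' j'
  proof (cases "i = i'")
    case True
    have "p i 0 \<noteq> p i (Suc 0)" using pp(1)[OF that(2)] irr by (metis irrefl_def)
    then show ?thesis using True that by (auto simp: less_2_cases_iff)
  next
    case False
    then have "{fst (e i), snd (e i)} \<inter> {fst (e i'), snd (e i')} = {}"
      using M eM einj that(2,3) unfolding matching_def by blast
    then show ?thesis using that(1) pe[of i j] pe[of i' j'] by auto
  qed
  have FV: "pverts (fan_graph k) = insert (Inl 0) (Inr ` ({..<k} \<times> {..<2}))"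
    by (auto simp: fan_graph_def graph_join_def complete_graph_def disjoint_copies_def)
  show ?thesis
  proof (rule not_graph_freeI[OF pair_graph_fan_graph G])
    show "inj_on h (pverts (fan_graph k))"
      unfolding FV
    proof (rule inj_onI)
      fix x y assume "x \<in> insert (Inl 0) (Inr ` ({..<k} \<times> {..<2}))"
        "y \<in> insert (Inl 0) (Inr ` ({..<k} \<times> {..<2}))" "h x = h y"
      then show "x = y"
        using pne pdist by (auto simp: h_def dest: sym)
    qed
    show "h ` pverts (fan_graph k) \<subseteq> pverts G"
      unfolding FV using u pu(3) by (auto simp: h_def)
    show "(h x, h y) \<in> parcs G" if "(x, y) \<in> parcs (fan_graph k)" for x y
      using that pu pp
      by (auto simp: h_def fan_graph_def graph_join_def complete_graph_def disjoint_copies_def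
          less_2_cases_iff)
  qed
qed

section \<open>The eigenvector equation and its invariance under isomorphism\<close>

lemma out_degree_with_proj:
  assumes "pair_graph G"
  shows "out_degree (with_proj G) u = deg (parcs G) (pverts G) u"
proof -
  have "out_arcs (with_proj G) u = Pair u ` nbhd (parcs G) (pverts G) u"
    using pair_graphD(2)[OF assms] by (auto simp: out_arcs_def nbhd_def)
  then show ?thesis by (simp add: out_degree_def card_image inj_on_def)
qed

lemma spectrum_signless_laplacian_iff:
  assumes "pair_graph G"
  shows "x \<in> spectrum (signless_laplacian G) \<longleftrightarrow>
    (\<exists>f. (\<exists>u\<in>pverts G. f u \<noteq> 0) \<and>
      (\<forall>u\<in>pverts G. real (deg (parcs G) (pverts G) u) * f u
          + (\<Sum>w\<in>nbhd (parcs G) (pverts G) u. f w) = x * f u))"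
  unfolding spectrum_signless_laplacian[OF pair_graphD(1)[OF assms]] out_degree_with_proj[OF assms]
  by (simp add: nbhd_def)

lemma spectrum_signless_laplacian_pullback:
  assumes G: "pair_graph G" and H: "pair_graph H" and bij: "bij_betw h (pverts G) (pverts H)"
    and iff: "\<And>u v. u \<in> pverts G \<Longrightarrow> v \<in> pverts G \<Longrightarrow> (u, v) \<in> parcs G \<longleftrightarrow> (h u, h v) \<in> parcs H"
  shows "spectrum (signless_laplacian H) \<subseteq> spectrum (signless_laplacian G)"
proof
  fix x assume "x \<in> spectrum (signless_laplacian H)"
  then obtain f where f: "\<exists>u\<in>pverts H. f u \<noteq> 0"
    "\<And>u. u \<in> pverts H \<Longrightarrow> real (deg (parcs H) (pverts H) u) * f u
          + (\<Sum>w\<in>nbhd (parcs H) (pverts H) u. f w) = x * f u"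
    unfolding spectrum_signless_laplacian_iff[OF H] by blast
  have V: "pverts H = h ` pverts G" and inj: "inj_on h (pverts G)"
    using bij by (auto simp: bij_betw_def)
  have nb: "nbhd (parcs H) (pverts H) (h u) = h ` nbhd (parcs G) (pverts G) u"
    if "u \<in> pverts G" for u
    using iff that by (auto simp: nbhd_def V)
  have inj': "inj_on h (nbhd (parcs G) (pverts G) u)" for u
    using inj nbhd_subset by (rule inj_on_subset)
  have "real (deg (parcs G) (pverts G) u) * f (h u)
      + (\<Sum>w\<in>nbhd (parcs G) (pverts G) u. f (h w)) = x * f (h u)" if "u \<in> pverts G" for u
  proof -
    have "h u \<in> pverts H" using that V by simp
    from f(2)[OF this] show ?thesis
      by (simp add: nb[OF that] card_image[OF inj'] sum.reindex[OF inj'])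
  qed
  moreover have "\<exists>u\<in>pverts G. f (h u) \<noteq> 0" using f(1) V by auto
  ultimately show "x \<in> spectrum (signless_laplacian G)"
    unfolding spectrum_signless_laplacian_iff[OF G] by (intro exI[of _ "\<lambda>u. f (h u)"]) auto
qed

lemma q1_digraph_iso:
  assumes G: "pair_graph G" and H: "pair_graph H"
    and iso: "digraph_iso (with_proj G) (with_proj H)"
  shows "q1 G = q1 H"
proof -
  obtain h where bij: "bij_betw h (pverts G) (pverts H)"
    and iff: "\<And>u v. u \<in> pverts G \<Longrightarrow> v \<in> pverts G \<Longrightarrow> (u, v) \<in> parcs G \<longleftrightarrow> (h u, h v) \<in> parcs H"
    using iso unfolding digraph_iso_with_proj_iff[OF G H] by blast
  let ?g = "the_inv_into (pverts G) h"
  have bij': "bij_betw ?g (pverts H) (pverts G)" by (rule bij_betw_the_inv_into[OF bij])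
  have gV: "?g u \<in> pverts G" and hg: "h (?g u) = u" if "u \<in> pverts H" for u
    using bij bij' that by (auto simp: bij_betw_def f_the_inv_into_f)
  have "spectrum (signless_laplacian G) \<subseteq> spectrum (signless_laplacian H)"
    by (rule spectrum_signless_laplacian_pullback[OF H G bij']) (simp add: iff gV hg)
  with spectrum_signless_laplacian_pullback[OF G H bij iff] show ?thesis
    by (simp add: q1_def subset_antisym)
qed

section \<open>The signless Laplacian spectrum\<close>

text \<open>The maximum defining \<open>q1\<close> needs a real eigenvalue. A complex one exists; it
  is real because the quadratic form of a symmetric real matrix is, and then the real or the
  imaginary part of the eigenvector is a real eigenvector.\<close>

lemma symmetric_real_spectrum_nonempty:
  fixes A :: "real mat"
  assumes A: "A \<in> carrier_mat n n" and n: "0 < n"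
    and symA: "\<And>i j. i < n \<Longrightarrow> j < n \<Longrightarrow> A $$ (i, j) = A $$ (j, i)"
  shows "spectrum A \<noteq> {}"
proof -
  let ?C = "map_mat complex_of_real A"
  have C: "?C \<in> carrier_mat n n" using A by simp
  obtain z where "z \<in> spectrum ?C" using spectrum_non_empty[OF C] n by auto
  then obtain w where w: "w \<in> carrier_vec n" "w \<noteq> 0\<^sub>v n" and ev: "?C *\<^sub>v w = z \<cdot>\<^sub>v w"
    using C by (auto simp: spectrum_def eigenvalue_def eigenvector_def)
  have row: "(\<Sum>j<n. complex_of_real (A $$ (i, j)) * w $ j) = z * w $ i" if "i < n" for i
  proof -
    have "(?C *\<^sub>v w) $ i = (\<Sum>j<n. complex_of_real (A $$ (i, j)) * w $ j)"
      using that A w(1) by (auto simp: scalar_prod_def lessThan_atLeast0 intro!: sum.cong)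
    then show ?thesis using that w(1) ev by simp
  qed
  define S where "S = (\<Sum>i<n. \<Sum>j<n. complex_of_real (A $$ (i, j)) * (cnj (w $ i) * w $ j))"
  define N where "N = (\<Sum>i<n. (cmod (w $ i))\<^sup>2)"
  have "cnj S = (\<Sum>i<n. \<Sum>j<n. complex_of_real (A $$ (i, j)) * (w $ i * cnj (w $ j)))"
    by (simp add: S_def cnj_sum)
  also have "\<dots> = (\<Sum>j<n. \<Sum>i<n. complex_of_real (A $$ (i, j)) * (w $ i * cnj (w $ j)))"
    by (rule sum.swap)
  also have "\<dots> = S"
    unfolding S_def using symA by (intro sum.cong refl) (simp add: mult_ac)
  finally have "Im S = 0" by (metis complex_cnj_cancel_iff complex_is_Real_iff Reals_cnj_iff)
  have "S = (\<Sum>i<n. cnj (w $ i) * (\<Sum>j<n. complex_of_real (A $$ (i, j)) * w $ j))"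
    unfolding S_def sum_distrib_left by (intro sum.cong refl) (simp add: mult_ac)
  also have "\<dots> = (\<Sum>i<n. cnj (w $ i) * (z * w $ i))"
    using row by (intro sum.cong refl) simp
  also have "\<dots> = z * complex_of_real N"
    unfolding N_def of_real_sum complex_norm_square sum_distrib_left
    by (intro sum.cong refl) (simp add: mult_ac)
  finally have "Im z * N = 0" using \<open>Im S = 0\<close> by simp
  moreover obtain i0 where i0: "i0 < n" "w $ i0 \<noteq> 0"
    using w by (metis carrier_vecD eq_vecI index_zero_vec)
  then have "0 < N"
    unfolding N_def by (intro sum_pos2[of _ i0]) auto
  ultimately have z: "z = complex_of_real (Re z)" by (simp add: complex_eq_iff)
  have real_eigenvector: "Re z \<in> spectrum A"
    if g: "\<And>i. i < n \<Longrightarrow> (\<Sum>j<n. A $$ (i, j) * g j) = Re z * g i" and ne: "g i0 \<noteq> 0" for g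
  proof -
    have "vec n g \<noteq> 0\<^sub>v n" using i0(1) ne by (metis index_vec index_zero_vec(1))
    moreover have "A *\<^sub>v vec n g = Re z \<cdot>\<^sub>v vec n g"
    proof (rule eq_vecI)
      fix i assume "i < dim_vec (Re z \<cdot>\<^sub>v vec n g)"
      then have i: "i < n" by simp
      have "(A *\<^sub>v vec n g) $ i = (\<Sum>j<n. A $$ (i, j) * g j)"
        using i A by (auto simp: scalar_prod_def lessThan_atLeast0 intro!: sum.cong)
      then show "(A *\<^sub>v vec n g) $ i = (Re z \<cdot>\<^sub>v vec n g) $ i" using g[OF i] i by simp
    qed (use A in auto)
    ultimately show ?thesis
      using A by (auto simp: spectrum_def eigenvalue_def eigenvector_def intro!: exI[of _ "vec n g"])
  qed
  have re: "(\<Sum>j<n. A $$ (i, j) * Re (w $ j)) = Re z * Re (w $ i)" if "i < n" for i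
    using arg_cong[OF row[OF that], of Re] by (subst (asm) z) simp
  have im: "(\<Sum>j<n. A $$ (i, j) * Im (w $ j)) = Re z * Im (w $ i)" if "i < n" for i
    using arg_cong[OF row[OF that], of Im] by (subst (asm) z) simp
  have "Re (w $ i0) \<noteq> 0 \<or> Im (w $ i0) \<noteq> 0" using i0(2) by (simp add: complex_eq_iff)
  then have "Re z \<in> spectrum A"
  proof
    assume "Re (w $ i0) \<noteq> 0"
    then show ?thesis using re by (intro real_eigenvector[of "\<lambda>j. Re (w $ j)"])
  next
    assume "Im (w $ i0) \<noteq> 0"
    then show ?thesis using im by (intro real_eigenvector[of "\<lambda>j. Im (w $ j)"])
  qed
  then show ?thesis by auto
qed

lemma q1_in_spectrum:
  assumes G: "pair_graph G" and ne: "pverts G \<noteq> {}"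
  shows "q1 G \<in> spectrum (signless_laplacian G)"
proof -
  have n: "0 < card (pverts G)" using pair_graphD(1)[OF G] ne by (simp add: card_gt_0_iff)
  have "(u, v) \<in> parcs G \<longleftrightarrow> (v, u) \<in> parcs G" for u v
    using pair_graphD(3)[OF G] by (meson symD)
  then have "spectrum (signless_laplacian G) \<noteq> {}"
    by (intro symmetric_real_spectrum_nonempty[OF signless_laplacian_carrier n])
      (simp add: signless_laplacian_def adjacency_matrix_def degree_matrix_def)
  then show ?thesis
    unfolding q1_def by (intro Max_in finite_spectrum_signless_laplacian)
qed

lemma le_q1:
  "x \<in> spectrum (signless_laplacian G) \<Longrightarrow> x \<le> q1 G"
  unfolding q1_def by (intro Max_ge finite_spectrum_signless_laplacian)

text \<open>
  The quadratic is the characteristic polynomial of the quotient matrix of the partition into the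
  clique and the independent set.
\<close>

lemma root_in_spectrum_complete_split_graph:
  fixes q :: real
  assumes k: "0 < k" and kn: "k < n"
    and q: "q\<^sup>2 - (real n + 2 * real k - 2) * q + 2 * real k * (real k - 1) = 0"
  shows "q \<in> spectrum (signless_laplacian (complete_split_graph n k))"
proof -
  let ?S = "complete_split_graph n k"
  define B where "B = (Inl ` {..<k} :: (nat + nat \<times> nat) set)"
  define I where "I = (Inr ` ({..<n - k} \<times> {0}) :: (nat + nat \<times> nat) set)"
  \<comment> \<open>These values solve the equation on the independent set for every
    \<open>q\<close>; on the clique the equation is the quadratic for \<open>q\<close>.\<close>
  define f where "f x = (case x of Inl _ \<Rightarrow> q - real k | Inr _ \<Rightarrow> real k)" for x :: "nat + nat \<times> nat"
  have V: "pverts ?S = B \<union> I"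
    by (auto simp: complete_split_graph_def graph_join_def complete_graph_def disjoint_copies_def
        B_def I_def)
  have fin: "finite B" "finite I" by (auto simp: B_def I_def)
  have disj: "B \<inter> I = {}" by (auto simp: B_def I_def)
  have cB: "card B = k" by (simp add: B_def card_image)
  have cI: "card I = n - k" by (simp add: I_def card_image card_cartesian_product)
  have fB: "f x = q - real k" if "x \<in> B" for x using that by (auto simp: B_def f_def)
  have fI: "f x = real k" if "x \<in> I" for x using that by (auto simp: I_def f_def)
  have nB: "nbhd (parcs ?S) (pverts ?S) u = (B - {u}) \<union> I" if "u \<in> B" for u
    using that unfolding V
    by (auto simp: nbhd_def complete_split_graph_def graph_join_def complete_graph_def
        disjoint_copies_def B_def I_def)
  have nI: "nbhd (parcs ?S) (pverts ?S) u = B" if "u \<in> I" for u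
    using that unfolding V
    by (auto simp: nbhd_def complete_split_graph_def graph_join_def complete_graph_def
        disjoint_copies_def B_def I_def)
  have onB: "real (deg (parcs ?S) (pverts ?S) u) * f u
      + (\<Sum>w\<in>nbhd (parcs ?S) (pverts ?S) u. f w) = q * f u" if u: "u \<in> B" for u
  proof -
    have "card ((B - {u}) \<union> I) = card (B - {u}) + card I"
      using fin disj by (intro card_Un_disjoint) auto
    then have "real (card ((B - {u}) \<union> I)) = real n - 1"
      using u fin cB cI k kn by (simp add: of_nat_diff)
    moreover have "(\<Sum>w\<in>(B - {u}) \<union> I. f w) = (\<Sum>w\<in>B - {u}. f w) + (\<Sum>w\<in>I. f w)"
      using fin disj by (intro sum.union_disjoint) auto
    moreover have "(\<Sum>w\<in>B - {u}. f w) = (real k - 1) * (q - real k)"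
      using fB u fin cB k by (simp add: of_nat_diff)
    moreover have "(\<Sum>w\<in>I. f w) = (real n - real k) * real k"
      using fI cI kn by (simp add: of_nat_diff)
    moreover have "(real n - 1) * (q - real k) + ((real k - 1) * (q - real k)
        + (real n - real k) * real k) = q * (q - real k)"
      using q by (simp add: algebra_simps power2_eq_square)
    ultimately show ?thesis by (simp only: nB[OF u] fB[OF u])
  qed
  have onI: "real (deg (parcs ?S) (pverts ?S) u) * f u
      + (\<Sum>w\<in>nbhd (parcs ?S) (pverts ?S) u. f w) = q * f u" if u: "u \<in> I" for u
  proof -
    have "(\<Sum>w\<in>B. f w) = real k * (q - real k)" using fB cB by simp
    then show ?thesis by (simp add: nI[OF u] fI[OF u] cB algebra_simps)
  qed
  have "Inr (0, 0) \<in> I" using kn by (simp add: I_def)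
  then have "\<exists>u\<in>pverts ?S. f u \<noteq> 0"
    using fI k by (intro bexI[of _ "Inr (0, 0)"]) (simp_all add: V)
  then show ?thesis
    unfolding spectrum_signless_laplacian_iff[OF pair_graph_complete_split_graph]
    using onB onI by (intro exI[of _ f]) (auto simp: V)
qed

text \<open>The quadratic changes sign on this interval of length 1, which is what makes the
  parameter \<open>s\<close> of the structure lemma lie strictly between 0 and 1.\<close>

lemma split_quadratic_root:
  fixes n k :: real
  assumes k: "2 \<le> k" and n: "3 * k\<^sup>2 - k - 2 \<le> n"
  obtains q where "q\<^sup>2 - (n + 2 * k - 2) * q + 2 * k * (k - 1) = 0"
    "n + 2 * k - 3 < q" "q < n + 2 * k - 2"
proof -
  define p where "p x = x\<^sup>2 - (n + 2 * k - 2) * x + 2 * k * (k - 1)" for x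
  have "4 \<le> k\<^sup>2" using power_mono[of 2 k 2] k by simp
  have lo: "p (n + 2 * k - 3) < 0"
  proof -
    have "p (n + 2 * k - 3) = 2 * k\<^sup>2 - 4 * k + 3 - n"
      by (simp add: p_def algebra_simps power2_eq_square)
    also have "\<dots> < 0" using n \<open>4 \<le> k\<^sup>2\<close> k by linarith
    finally show ?thesis .
  qed
  have hi: "0 < p (n + 2 * k - 2)" using k by (simp add: p_def power2_eq_square)
  have "\<exists>q\<ge>n + 2 * k - 3. q \<le> n + 2 * k - 2 \<and> p q = 0"
    using lo hi by (intro IVT) (auto simp: p_def intro!: continuous_intros)
  then obtain q where q: "n + 2 * k - 3 \<le> q" "q \<le> n + 2 * k - 2" "p q = 0" by blast
  then have "q \<noteq> n + 2 * k - 3" "q \<noteq> n + 2 * k - 2" using lo hi by auto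
  then show ?thesis using q that[of q] by (simp add: p_def)
qed

section \<open>Identification of the extremal graph\<close>

lemma q1_ge_root_imp_complete_split_graph:
  fixes G :: "'a pair_pre_digraph" and n k :: nat and q :: real
  assumes k: "2 \<le> k" and n: "3 * (real k)\<^sup>2 - real k - 2 \<le> real n"
    and G: "pair_graph G" and card: "card (pverts G) = n" and free: "graph_free (fan_graph k) G"
    and q: "q\<^sup>2 - (real n + 2 * real k - 2) * q + 2 * real k * (real k - 1) = 0"
      "real n + 2 * real k - 3 < q" "q < real n + 2 * real k - 2"
    and ge: "q \<le> q1 G"
  shows "digraph_iso (with_proj G) (with_proj (complete_split_graph n k))"
proof -
  let ?V = "pverts G" and ?E = "parcs G" and ?S = "complete_split_graph n k"
  define lam where "lam = q1 G"
  have fin: "finite ?V" and symE: "sym ?E" and irr: "irrefl ?E"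
    using pair_graphD[OF G] by auto
  have "4 \<le> (real k)\<^sup>2" "2 * real k \<le> (real k)\<^sup>2"
    using power_mono[of 2 "real k" 2] k by (auto simp: power2_eq_square)
  then have kn: "k < n" using n k by linarith
  have nlam: "real n < lam" using q(2) ge k by (simp add: lam_def)
  have "?V \<noteq> {}" using card kn by auto
  then obtain f where f: "\<exists>u\<in>?V. f u \<noteq> 0"
    "\<And>u. u \<in> ?V \<Longrightarrow> real (deg ?E ?V u) * f u + (\<Sum>w\<in>nbhd ?E ?V u. f w) = lam * f u"
    using q1_in_spectrum[OF G] unfolding lam_def spectrum_signless_laplacian_iff[OF G] by blast
  define y where "y u = \<bar>f u\<bar>" for u
  have y_nonneg: "0 \<le> y u" if "u \<in> ?V" for u by (simp add: y_def)
  have y_pos: "\<exists>u\<in>?V. 0 < y u" using f(1) by (simp add: y_def)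
  have sub: "lam * y u \<le> real (deg ?E ?V u) * y u + (\<Sum>w\<in>nbhd ?E ?V u. y w)" if "u \<in> ?V" for u
  proof -
    have "lam * y u = \<bar>lam * f u\<bar>" using nlam by (simp add: y_def abs_mult)
    also have "\<dots> = \<bar>real (deg ?E ?V u) * f u + (\<Sum>w\<in>nbhd ?E ?V u. f w)\<bar>"
      using f(2)[OF that] by simp
    also have "\<dots> \<le> \<bar>real (deg ?E ?V u) * f u\<bar> + \<bar>\<Sum>w\<in>nbhd ?E ?V u. f w\<bar>"
      by (rule abs_triangle_ineq)
    also have "\<dots> \<le> real (deg ?E ?V u) * y u + (\<Sum>w\<in>nbhd ?E ?V u. y w)"
      using sum_abs[of f "nbhd ?E ?V u"] by (simp add: y_def abs_mult)
    finally show ?thesis .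
  qed
  obtain v where v: "v \<in> ?V" "0 < deg ?E ?V v"
    and vle: "lam * real (deg ?E ?V v)
      \<le> (real (deg ?E ?V v))\<^sup>2 + real (\<Sum>u\<in>nbhd ?E ?V v. deg ?E ?V u)"
    using weighted_degree_bound[OF fin symE y_nonneg y_pos _ sub] nlam by auto
  define s where "s = real n + 2 * real k - 2 - q"
  have "real (deg ?E ?V v) * (2 * real k - 2 - s)
      \<le> real (\<Sum>u\<in>nbhd ?E ?V v. deg ?E (nbhd ?E ?V v) u)
        - real (\<Sum>u\<in>nbhd ?E ?V v. deg (- ?E) (?V - nbhd ?E ?V v - {v}) u)"
  proof -
    have "real (deg ?E ?V v) * (2 * real k - 2 - s) \<le> real (deg ?E ?V v) * (lam - real n)"
      using ge by (intro mult_left_mono) (auto simp: s_def lam_def)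
    then show ?thesis
      using vle sum_deg_nbhd_eq[OF fin symE irr v(1)] by (simp add: card algebra_simps)
  qed
  moreover have "card M < k" if "u \<in> ?V" "matching ?E (nbhd ?E ?V u) M" for u M
  proof (rule ccontr)
    \<comment> \<open>A larger matching is cut down to exactly \<open>k\<close> edges, as the fan
      requires.\<close>
    assume "\<not> ?thesis"
    then obtain M' where M': "M' \<subseteq> M" "card M' = k"
      by (meson leI obtain_subset_with_card_n)
    have "matching ?E (nbhd ?E ?V u) M'" using that(2) M'(1) unfolding matching_def by blast
    then show False using not_fan_free_if_matching[OF G that(1) _ M'(2)] free by blast
  qed
  ultimately obtain I where I: "I \<subseteq> ?V" "\<And>i j. i \<in> I \<Longrightarrow> j \<in> I \<Longrightarrow> (i, j) \<notin> ?E"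
    "k \<le> card (?V - I)" "\<And>u. u \<in> ?V - I \<Longrightarrow> deg ?E (?V - I) u < k"
    using fan_free_join_structure[OF fin symE irr k, of s v] n q(2,3) v unfolding s_def card
    by auto
  \<comment> \<open>The second root is \<open>n + 2 * k - 2 - q\<close>, which is less than 1, so
    \<open>lam\<close> lies to the right of both roots.\<close>
  have poly: "0 \<le> lam\<^sup>2 - (real n + 2 * real k - 2) * lam + 2 * real k * (real k - 1)"
  proof -
    have "lam\<^sup>2 - (real n + 2 * real k - 2) * lam + 2 * real k * (real k - 1)
        = (lam - q) * (lam + q - (real n + 2 * real k - 2))"
      using q(1) by (simp add: algebra_simps power2_eq_square)
    moreover have "0 \<le> (lam - q) * (lam + q - (real n + 2 * real k - 2))"
      using ge q(2) nlam k kn by (intro mult_nonneg_nonneg) (auto simp: lam_def)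
    ultimately show ?thesis by simp
  qed
  have kV: "k < card ?V" and nV: "real (card ?V) < lam"
    and polyV: "0 \<le> lam\<^sup>2 - (real (card ?V) + 2 * real k - 2) * lam + 2 * real k * (real k - 1)"
    using kn nlam poly by (simp_all add: card)
  note split = subeigenvector_forces_complete_split[where V = ?V and E = ?E and I = I and y = y
      and lam = lam and k = k]
  have cVI: "card (?V - I) = k" by (rule split(1); fact)
  have adjB: "(a, b) \<in> ?E" if "a \<in> ?V - I" "b \<in> ?V - I" "a \<noteq> b" for a b
    by (rule split(2); fact)
  have adjI: "(a, i) \<in> ?E" if "a \<in> ?V - I" "i \<in> I" for a i
    by (rule split(3); fact)
  define B where "B = ?V - I"
  have finB: "finite B" and finI: "finite I" using fin I(1) finite_subset by (auto simp: B_def)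
  have cB: "card B = k" using cVI by (simp add: B_def)
  have cI: "card I = n - k"
    using card_Diff_subset[OF finI I(1)] cB card card_mono[OF fin I(1)] kn by (simp add: B_def)
  obtain g where g: "bij_betw g B {..<k}"
    using finB cB by (metis card_lessThan finite_lessThan finite_same_card_bij)
  obtain h where h: "bij_betw h I {..<n - k}"
    using finI cI by (metis card_lessThan finite_lessThan finite_same_card_bij)
  define \<phi> where "\<phi> u = (if u \<in> B then Inl (g u) else Inr (h u, 0::nat))" for u
  have VBI: "?V = B \<union> I" "B \<inter> I = {}" using I(1) by (auto simp: B_def)
  have gk: "g u < k" if "u \<in> B" for u using g that by (auto simp: bij_betw_def)
  have hk: "h u < n - k" if "u \<in> I" for u using h that by (auto simp: bij_betw_def)
  have ginj: "g u = g v \<longleftrightarrow> u = v" if "u \<in> B" "v \<in> B" for u v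
    using g that by (auto simp: bij_betw_def dest: inj_onD)
  have hinj: "h u = h v \<longleftrightarrow> u = v" if "u \<in> I" "v \<in> I" for u v
    using h that by (auto simp: bij_betw_def dest: inj_onD)
  have \<phi>B: "\<phi> u = Inl (g u)" if "u \<in> B" for u using that by (simp add: \<phi>_def)
  have \<phi>I: "\<phi> u = Inr (h u, 0)" if "u \<in> I" for u using that VBI(2) by (auto simp: \<phi>_def)
  have SV: "pverts ?S = Inl ` {..<k} \<union> Inr ` ({..<n - k} \<times> {0})"
    by (auto simp: complete_split_graph_def graph_join_def complete_graph_def disjoint_copies_def)
  show ?thesis
    unfolding digraph_iso_with_proj_iff[OF G pair_graph_complete_split_graph]
  proof (intro exI conjI ballI)
    have "inj_on \<phi> (B \<union> I)"
    proof (rule inj_onI)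
      fix u v assume "u \<in> B \<union> I" "v \<in> B \<union> I" "\<phi> u = \<phi> v"
      then show "u = v" using ginj hinj by (auto simp: \<phi>B \<phi>I)
    qed
    moreover have "\<phi> ` B = Inl ` {..<k}"
    proof -
      have "\<phi> ` B = (\<lambda>u. Inl (g u)) ` B" by (rule image_cong) (simp_all add: \<phi>B)
      also have "\<dots> = Inl ` (g ` B)" by (simp only: image_image)
      also have "g ` B = {..<k}" using g by (simp add: bij_betw_def)
      finally show ?thesis .
    qed
    moreover have "\<phi> ` I = Inr ` ({..<n - k} \<times> {0})"
    proof -
      have "\<phi> ` I = (\<lambda>u. Inr (h u, 0)) ` I" by (rule image_cong) (simp_all add: \<phi>I)
      also have "\<dots> = Inr ` ((\<lambda>j. (j, 0)) ` (h ` I))" by (simp only: image_image)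
      also have "h ` I = {..<n - k}" using h by (simp add: bij_betw_def)
      also have "(\<lambda>j. (j, 0)) ` {..<n - k} = {..<n - k} \<times> {0::nat}" by auto
      finally show ?thesis .
    qed
    ultimately show "bij_betw \<phi> ?V (pverts ?S)"
      by (simp add: bij_betw_def VBI(1) SV image_Un)
    fix u v assume uv: "u \<in> ?V" "v \<in> ?V"
    have BB: "(u, v) \<in> ?E \<longleftrightarrow> u \<noteq> v" if "u \<in> B" "v \<in> B"
      using adjB[of u v] that irr unfolding B_def irrefl_def by blast
    have BI: "(u, v) \<in> ?E" if "u \<in> B" "v \<in> I" using adjI[of u v] that by (simp add: B_def)
    have IB: "(u, v) \<in> ?E" if "u \<in> I" "v \<in> B"
      using adjI[of v u] that symD[OF symE, of v u] by (simp add: B_def)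
    have II: "(u, v) \<notin> ?E" if "u \<in> I" "v \<in> I" using I(2) that by blast
    consider "u \<in> B" "v \<in> B" | "u \<in> B" "v \<in> I" | "u \<in> I" "v \<in> B" | "u \<in> I" "v \<in> I"
      using uv VBI(1) by blast
    then show "(u, v) \<in> ?E \<longleftrightarrow> (\<phi> u, \<phi> v) \<in> parcs ?S"
    proof cases
      case 1
      then show ?thesis using BB gk ginj[of u v]
        by (auto simp: \<phi>B complete_split_graph_def graph_join_def complete_graph_def)
    next
      case 2
      then show ?thesis using BI gk hk
        by (auto simp: \<phi>B \<phi>I complete_split_graph_def graph_join_def complete_graph_def
            disjoint_copies_def)
    next
      case 3
      then show ?thesis using IB gk hk
        by (auto simp: \<phi>B \<phi>I complete_split_graph_def graph_join_def complete_graph_def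
            disjoint_copies_def)
    next
      case 4
      then show ?thesis using II
        by (auto simp: \<phi>I complete_split_graph_def graph_join_def complete_graph_def
            disjoint_copies_def)
    qed
  qed
qed

theorem theorem1p3:
  fixes G :: "'a pair_pre_digraph" and n k :: nat
  assumes "k \<ge> 2"
    and "int n \<ge> 3 * (int k)^2 - int k - 2"
    and "pair_graph G"
    and "card (pverts G) = n"
    and "graph_free (fan_graph k) G"
  shows "q1 G \<le> q1 (complete_split_graph n k)
    \<and> (q1 G = q1 (complete_split_graph n k)
        \<longleftrightarrow> digraph_iso (with_proj G) (with_proj (complete_split_graph n k)))"
proof -
  let ?S = "complete_split_graph n k"
  have "real_of_int (3 * (int k)^2 - int k - 2) \<le> real_of_int (int n)"
    using assms(2) by (rule of_int_le_iff[THEN iffD2])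
  then have n: "3 * (real k)\<^sup>2 - real k - 2 \<le> real n" by simp
  obtain q where q: "q\<^sup>2 - (real n + 2 * real k - 2) * q + 2 * real k * (real k - 1) = 0"
      "real n + 2 * real k - 3 < q" "q < real n + 2 * real k - 2"
    using split_quadratic_root[OF _ n] assms(1) by auto
  have "4 \<le> (real k)\<^sup>2" "2 * real k \<le> (real k)\<^sup>2"
    using power_mono[of 2 "real k" 2] assms(1) by (auto simp: power2_eq_square)
  then have "k < n" using n assms(1) by linarith
  then have "q \<le> q1 ?S"
    using assms(1) q(1) by (intro le_q1 root_in_spectrum_complete_split_graph) auto
  \<comment> \<open>Since \<open>q\<close> is at most \<open>q1 ?S\<close>, this covers every graph
    with \<open>q1 G\<close> at least \<open>q1 ?S\<close>. Such a graph is isomorphic to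
    \<open>?S\<close> and then has equal \<open>q1\<close>, which excludes a strictly larger value
    and settles equality.\<close>
  moreover have "digraph_iso (with_proj G) (with_proj ?S)" if "q \<le> q1 G"
    using q1_ge_root_imp_complete_split_graph[OF assms(1) n assms(3-5) q that] .
  moreover have "q1 G = q1 ?S" if "digraph_iso (with_proj G) (with_proj ?S)"
    using q1_digraph_iso[OF assms(3) pair_graph_complete_split_graph that] .
  ultimately show ?thesis by force
qed

end
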